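(* Let $[v],[w]$ be two elements of $W/W_J$ and assume that $v,w \in W$ are the minimal-length elements of $[v],[w]$ respectively. Fix a reduced word for $v$, say $v=b_1\cdots b_l$ with each $b_i$ a simple reflection. Let $R(w)$ denote the set of reduced words for $w$, and for each $i$ let $r_b(i)=b_1b_2 \cdots b_{i-1}(\alpha_{b_i})$, where $\alpha_{b_i}$ is the simple root whose reflection is $b_i$. Then \[p_{[w]}([v]) = p_w(v) = \sum_{b_{i_1}\cdots b_{i_k} \in R(w)} r_b(i_1)\, r_b(i_2)\cdots r_b(i_k),\] where the sum is over $1 \leq i_1 < i_2 < \cdots < i_k \leq l$ with $b_{i_1}\cdots b_{i_k} \in R(w)$. Here $p_{[w]}$ is the flow-up class in $H^*_T(G/P)$ and $p_w$ is the flow-up class in $H^*_T(G/B)$.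
   Context: $G$ is a complex semisimple linear algebraic group, $T \subseteq B \subseteq P \subseteq G$ with $T$ a maximal torus, $B$ a Borel subgroup, $P$ a parabolic subgroup; $\mathfrak{t} = \mathrm{Lie}(T)$. $W=N(T)/T$ is the Weyl group, $\Delta^+$ the positive roots (those of $B$), $\alpha_1,\dots,\alpha_n$ the simple roots, $s_1,\dots,s_n$ the simple reflections, $s_\alpha$ the reflection in $\alpha$. $J \subseteq \{1,\dots,n\}$ is the subset corresponding to $P$ (so $i\in J$ iff $\mathfrak{g}_{-\alpha_i} \subseteq \mathrm{Lie}(P)$), $W_J = \langle s_i : i \in J\rangle$, $[w]=wW_J \in W/W_J$, and $\le_P$ is the Bruhat order on $W/W_J$, i.e. the Bruhat order of $W$ on unique minimal-length coset representatives. $S(\mathfrak{t}^* )$ is the symmetric algebra over $\mathbb{C}$. Cohomology has complex coefficients, and $H^*_T(G/P)$ is given in its GKM presentation: it is the ring (coordinatewise operations) of functions $p : W/W_J \to S(\mathfrak{t}^* )$ such that $p([s_\alpha w]) - p([w]) \in (\alpha)$ for all $w \in W$ and $\alpha\in\Delta^+$ with $[s_\alpha w] \neq [w]$. Moment graph of $G/P$: vertices $W/W_J$; for $\alpha \in \Delta^+$ there is an edge labeled $\alpha$ between $[w]$ and $[s_\alpha w]$ whenever $[s_\alpha w]\neq [w]$, directed $[w] \mapsto [s_\alpha w]$ if $w^{-1}(\alpha)<0$ and $[s_\alpha w]\mapsto [w]$ otherwise. The flow-up (equivariant Schubert) class $p_{[w]} \in H^*_T(G/P)$ is the homogeneous class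 supported exactly on the $[v]$ with $[v] \ge_P [w]$ and with $p_{[w]}([w])$ equal to the product of the labels of all edges directed out of $[w]$; these classes exist. The corresponding notions for $G/B$ are the case $P=B$, $J=\emptyset$, $W/W_J = W$, with flow-up classes written $p_w$. *)

theory Defs
  imports "HOL-Analysis.Analysis" "HOL-Library.Poly_Mapping"
begin

text \<open>
  The groups \<open>T \<subseteq> B \<subseteq> P \<subseteq> G\<close> enter only through their root data: the roots of \<open>(G, T)\<close>,
  the simple roots \<open>\<alpha>\<^sub>1, \<dots>, \<alpha>\<^sub>n\<close> determined by \<open>B\<close>, and the subset \<open>J\<close> of \<open>{1..n}\<close> determined
  by \<open>P\<close>.  The roots live in a real inner product space whose inner product restricts to a
  Weyl-invariant one on the real span \<open>E\<close> of the roots.  As \<open>G\<close> is semisimple, \<open>\<tt>\<^sup>*\<close> is the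
  complexification of \<open>E\<close>, with the simple roots as a basis.  The roots are not required to span
  the ambient type, so that rank \<open>0\<close> is included.
\<close>

record 'v root_data =
  roots :: "'v set"
  rank :: nat
  simple_root :: "nat \<Rightarrow> 'v"

definition reflection :: "'v::real_inner \<Rightarrow> 'v \<Rightarrow> 'v" where
  "reflection a x = x - (2 * inner x a / inner a a) *\<^sub>R a"

definition root_system :: "'v::real_inner set \<Rightarrow> bool" where
  "root_system \<Phi> \<longleftrightarrow>
     finite \<Phi> \<and> 0 \<notin> \<Phi> \<and>
     (\<forall>a\<in>\<Phi>. \<forall>b\<in>\<Phi>. reflection a b \<in> \<Phi>) \<and>
     (\<forall>a\<in>\<Phi>. \<forall>b\<in>\<Phi>. 2 * inner b a / inner a a \<in> \<int>) \<and>
     (\<forall>a\<in>\<Phi>. \<forall>c. c *\<^sub>R a \<in> \<Phi> \<longrightarrow> c = 1 \<or> c = -1)"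

definition pos_roots :: "'v::real_inner root_data \<Rightarrow> 'v set" where
  "pos_roots R = {b \<in> roots R. \<exists>c :: nat \<Rightarrow> nat.
     b = (\<Sum>i=1..rank R. real (c i) *\<^sub>R simple_root R i)}"

definition neg_roots :: "'v::real_inner root_data \<Rightarrow> 'v set" where
  "neg_roots R = uminus ` pos_roots R"

definition based_root_system :: "'v::real_inner root_data \<Rightarrow> bool" where
  "based_root_system R \<longleftrightarrow>
     root_system (roots R) \<and>
     inj_on (simple_root R) {1..rank R} \<and>
     simple_root R ` {1..rank R} \<subseteq> roots R \<and>
     independent (simple_root R ` {1..rank R}) \<and>
     roots R \<subseteq> pos_roots R \<union> neg_roots R"


text \<open>
  Since reflections are involutions, the monoid generated by a set of reflections is the group
  generated by them.
\<close>

inductive_set reflection_group :: "'v::real_inner set \<Rightarrow> ('v \<Rightarrow> 'v) set"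
  for A :: "'v set" where
  one: "id \<in> reflection_group A"
| step: "w \<in> reflection_group A \<Longrightarrow> a \<in> A \<Longrightarrow> reflection a \<circ> w \<in> reflection_group A"

definition weyl :: "'v::real_inner root_data \<Rightarrow> ('v \<Rightarrow> 'v) set" where
  "weyl R = reflection_group (roots R)"

definition parabolic :: "'v::real_inner root_data \<Rightarrow> nat set \<Rightarrow> ('v \<Rightarrow> 'v) set" where
  "parabolic R J = reflection_group (simple_root R ` J)"

definition coset :: "'v::real_inner root_data \<Rightarrow> nat set \<Rightarrow> ('v \<Rightarrow> 'v) \<Rightarrow> ('v \<Rightarrow> 'v) set" where
  "coset R J w = {w \<circ> u |u. u \<in> parabolic R J}"

definition weyl_quot :: "'v::real_inner root_data \<Rightarrow> nat set \<Rightarrow> ('v \<Rightarrow> 'v) set set" where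
  "weyl_quot R J = coset R J ` weyl R"


text \<open>A word \<open>[i, j, \<dots>]\<close> of indices of simple reflections stands for \<open>s\<^sub>i \<circ> s\<^sub>j \<circ> \<dots>\<close>.\<close>

definition word_prod :: "'v::real_inner root_data \<Rightarrow> nat list \<Rightarrow> 'v \<Rightarrow> 'v" where
  "word_prod R bs = foldr (\<lambda>i f. reflection (simple_root R i) \<circ> f) bs id"

definition is_word :: "'v::real_inner root_data \<Rightarrow> nat list \<Rightarrow> ('v \<Rightarrow> 'v) \<Rightarrow> bool" where
  "is_word R bs w \<longleftrightarrow> set bs \<subseteq> {1..rank R} \<and> word_prod R bs = w"

definition weyl_length :: "'v::real_inner root_data \<Rightarrow> ('v \<Rightarrow> 'v) \<Rightarrow> nat" where
  "weyl_length R w = (LEAST k. \<exists>bs. is_word R bs w \<and> length bs = k)"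

definition reduced_words :: "'v::real_inner root_data \<Rightarrow> ('v \<Rightarrow> 'v) \<Rightarrow> nat list set" where
  "reduced_words R w = {bs. is_word R bs w \<and> length bs = weyl_length R w}"

definition min_rep ::
  "'v::real_inner root_data \<Rightarrow> ('v \<Rightarrow> 'v) set \<Rightarrow> ('v \<Rightarrow> 'v) \<Rightarrow> bool" where
  "min_rep R C u \<longleftrightarrow> u \<in> C \<and> (\<forall>x\<in>C. weyl_length R u \<le> weyl_length R x)"

definition bruhat_step ::
  "'v::real_inner root_data \<Rightarrow> ('v \<Rightarrow> 'v) \<Rightarrow> ('v \<Rightarrow> 'v) \<Rightarrow> bool" where
  "bruhat_step R u v \<longleftrightarrow>
     (\<exists>a \<in> pos_roots R. v = reflection a \<circ> u \<and> weyl_length R u < weyl_length R v)"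

definition bruhat_le ::
  "'v::real_inner root_data \<Rightarrow> ('v \<Rightarrow> 'v) \<Rightarrow> ('v \<Rightarrow> 'v) \<Rightarrow> bool" where
  "bruhat_le R = (bruhat_step R)\<^sup>*\<^sup>*"

definition quot_le ::
  "'v::real_inner root_data \<Rightarrow> ('v \<Rightarrow> 'v) set \<Rightarrow> ('v \<Rightarrow> 'v) set \<Rightarrow> bool" where
  "quot_le R C D \<longleftrightarrow> (\<exists>u v. min_rep R C u \<and> min_rep R D v \<and> bruhat_le R u v)"


text \<open>
  \<open>S(\<tt>\<^sup>*)\<close> is the complex polynomial algebra on the basis \<open>\<alpha>\<^sub>1, \<dots>, \<alpha>\<^sub>n\<close> of \<open>\<tt>\<^sup>*\<close>: the variable
  with index \<open>i\<close> is \<open>\<alpha>\<^sub>i\<close>, and \<open>lin\<close> is the inclusion of \<open>E \<subseteq> \<tt>\<^sup>*\<close> into \<open>S(\<tt>\<^sup>*)\<close>.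
\<close>

type_synonym cpoly = "(nat \<Rightarrow>\<^sub>0 nat) \<Rightarrow>\<^sub>0 complex"

definition sym_alg :: "'v::real_inner root_data \<Rightarrow> cpoly set" where
  "sym_alg R = {f. \<forall>m \<in> Poly_Mapping.keys f. Poly_Mapping.keys m \<subseteq> {1..rank R}}"

definition lin :: "'v::real_inner root_data \<Rightarrow> 'v \<Rightarrow> cpoly" where
  "lin R b = (\<Sum>i=1..rank R. Poly_Mapping.single (Poly_Mapping.single i 1)
     (complex_of_real (representation (simple_root R ` {1..rank R}) b (simple_root R i))))"

definition principal_ideal :: "'v::real_inner root_data \<Rightarrow> 'v \<Rightarrow> cpoly set" where
  "principal_ideal R b = {lin R b * f |f. f \<in> sym_alg R}"

definition homogeneous :: "nat \<Rightarrow> cpoly \<Rightarrow> bool" where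
  "homogeneous d f \<longleftrightarrow>
     (\<forall>m \<in> Poly_Mapping.keys f. (\<Sum>i \<in> Poly_Mapping.keys m. Poly_Mapping.lookup m i) = d)"


text \<open>The values of a class outside \<open>W/W\<^sub>J\<close> are irrelevant and left unconstrained.\<close>

definition equiv_cohomology ::
  "'v::real_inner root_data \<Rightarrow> nat set \<Rightarrow> (('v \<Rightarrow> 'v) set \<Rightarrow> cpoly) set" where
  "equiv_cohomology R J = {p \<in> weyl_quot R J \<rightarrow> sym_alg R.
     \<forall>w \<in> weyl R. \<forall>a \<in> pos_roots R. coset R J (reflection a \<circ> w) \<noteq> coset R J w \<longrightarrow>
       p (coset R J (reflection a \<circ> w)) - p (coset R J w) \<in> principal_ideal R a}"

text \<open>Edges are triples (source, label, target).\<close>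

definition moment_graph ::
  "'v::real_inner root_data \<Rightarrow> nat set \<Rightarrow> (('v \<Rightarrow> 'v) set \<times> 'v \<times> ('v \<Rightarrow> 'v) set) set" where
  "moment_graph R J =
     {(coset R J w, a, coset R J (reflection a \<circ> w)) |w a.
        w \<in> weyl R \<and> a \<in> pos_roots R \<and> coset R J (reflection a \<circ> w) \<noteq> coset R J w \<and>
        inv w a \<in> neg_roots R} \<union>
     {(coset R J (reflection a \<circ> w), a, coset R J w) |w a.
        w \<in> weyl R \<and> a \<in> pos_roots R \<and> coset R J (reflection a \<circ> w) \<noteq> coset R J w \<and>
        inv w a \<notin> neg_roots R}"

text \<open>
  \<open>flow_up_class R J C p\<close>: \<open>p\<close> is the flow-up class of the vertex \<open>C\<close> of the moment graph of
  \<open>G/P\<close>.  For \<open>G/B\<close> take \<open>J = {}\<close>, in which case \<open>coset R {} w = {w}\<close>.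
\<close>

definition flow_up_class ::
  "'v::real_inner root_data \<Rightarrow> nat set \<Rightarrow> ('v \<Rightarrow> 'v) set \<Rightarrow> (('v \<Rightarrow> 'v) set \<Rightarrow> cpoly) \<Rightarrow> bool" where
  "flow_up_class R J C p \<longleftrightarrow>
     p \<in> equiv_cohomology R J \<and>
     (\<exists>d. \<forall>D \<in> weyl_quot R J. homogeneous d (p D)) \<and>
     (\<forall>D \<in> weyl_quot R J. p D \<noteq> 0 \<longleftrightarrow> quot_le R C D) \<and>
     p C = (\<Prod>(C', a, D) \<in> {e \<in> moment_graph R J. fst e = C}. lin R a)"


text \<open>
  Positions in a word are counted from \<open>0\<close>: \<open>r_root R bs i\<close> is \<open>r\<^sub>b(i + 1)\<close> of the usual
  numbering \<open>b\<^sub>1 \<cdots> b\<^sub>l\<close>.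
\<close>

definition r_root :: "'v::real_inner root_data \<Rightarrow> nat list \<Rightarrow> nat \<Rightarrow> 'v" where
  "r_root R bs i = word_prod R (take i bs) (simple_root R (bs ! i))"

end

theory Submission
  imports Defs
begin

text \<open>
  Both equalities come from one description of flow-up classes in which only lengths of Weyl
  group elements occur.  Call a function \<open>f\<close> on \<open>W\<close> a Schubert class of \<open>w\<close> if it satisfies the
  divisibility conditions along all reflections, is homogeneous of degree \<open>\<ell>(w)\<close>, vanishes at every
  \<open>v \<noteq> w\<close> with \<open>\<ell>(v) \<le> \<ell>(w)\<close>, and has at \<open>w\<close> the product of the inversions of \<open>w\<close> (the positive
  \<open>a\<close> with \<open>w\<^sup>-\<^sup>1 a < 0\<close>) as its value.

  Such conditions are rigid (\<open>gkm_vanishing\<close>).  Let a class of degree \<open>d\<close> vanish at all elements of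
  length at most \<open>d\<close>, and let \<open>v\<close> be an element of minimal length in its support.  Each of the
  \<open>\<ell>(v)\<close> inversions \<open>a\<close> of \<open>v\<close> leads to a shorter element \<open>s\<^sub>a v\<close>, so it divides the value at \<open>v\<close>.
  Inversions are pairwise non-proportional linear forms, hence pairwise coprime primes; so their
  product divides the value, whose degree would be at least \<open>\<ell>(v) > d\<close>.

  Right divided differences \<open>g(v) = (f(v s\<^sub>i) - f(v)) / v(\<alpha>\<^sub>i)\<close> preserve the divisibility
  conditions and lower the degree by one.  By rigidity they send a Schubert class of \<open>w\<close> to one of
  \<open>w s\<^sub>i\<close> if that is shorter, and to zero otherwise
  (\<open>schubert_class_divided_difference\<close>).  Therefore \<open>f(v s\<^sub>i) = f(v) + v(\<alpha>\<^sub>i) g(v)\<close> determines all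
  values of \<open>f\<close> along a word, one letter at a time.  The sum over subwords obeys the same recursion:
  a subword of \<open>b\<^sub>1 \<cdots> b\<^sub>l s\<^sub>i\<close> that is reduced for \<open>w\<close> either avoids the last letter, or is a reduced
  word for \<open>w s\<^sub>i\<close> followed by \<open>s\<^sub>i\<close>, and the root of the last letter is \<open>b\<^sub>1 \<cdots> b\<^sub>l(\<alpha>\<^sub>i)\<close>.
  So every Schubert class of \<open>w\<close> is given by that sum (\<open>schubert_class_eq_subword_sum\<close>).

  It remains to see that \<open>v \<mapsto> p\<^bsub>[w]\<^esub>([v])\<close> is a Schubert class of \<open>w\<close> when \<open>w\<close> is minimal in its
  coset (\<open>schubert_class_flow_up_class\<close>).  This gives both equalities at once, because \<open>p\<^sub>w\<close> is the
  case of the trivial parabolic.  For minimal \<open>w\<close> the edges out of \<open>[w]\<close> are labelled exactly by the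
  inversions of \<open>w\<close>, and the vanishing follows from uniqueness of minimal representatives.

  The Weyl group input is the exchange property (\<open>exchange\<close>), proved for words in any set of simple
  reflections, so that it applies to \<open>W\<close> and to \<open>W\<^sub>J\<close>.
\<close>


section \<open>Substitution, linear forms and degrees in polynomial rings\<close>

abbreviation cst :: "complex \<Rightarrow> cpoly" where
  "cst c \<equiv> Poly_Mapping.single 0 c"

abbreviation var :: "nat \<Rightarrow> cpoly" where
  "var i \<equiv> Poly_Mapping.single (Poly_Mapping.single i 1) 1"

definition mon_eval :: "(nat \<Rightarrow> cpoly) \<Rightarrow> (nat \<Rightarrow>\<^sub>0 nat) \<Rightarrow> cpoly" where
  "mon_eval y m = (\<Prod>i\<in>Poly_Mapping.keys m. y i ^ Poly_Mapping.lookup m i)"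

text \<open>
  The ring endomorphism sending the variable \<open>i\<close> to \<open>y i\<close>.  Two of them carry the algebra below:
  eliminating a variable, whose kernel is the ideal of a linear form, and doubling all variables,
  whose eigenspaces are the homogeneous parts.
\<close>

definition poly_subst :: "(nat \<Rightarrow> cpoly) \<Rightarrow> cpoly \<Rightarrow> cpoly" where
  "poly_subst y f = (\<Sum>m\<in>Poly_Mapping.keys f. cst (Poly_Mapping.lookup f m) * mon_eval y m)"

lemma poly_mapping_sum_singles:
  "f = (\<Sum>m\<in>Poly_Mapping.keys f. Poly_Mapping.single m (Poly_Mapping.lookup f m))"
proof (rule poly_mapping_eqI)
  fix k
  show "Poly_Mapping.lookup f k =
      Poly_Mapping.lookup (\<Sum>m\<in>Poly_Mapping.keys f. Poly_Mapping.single m (Poly_Mapping.lookup f m)) k"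
    by (cases "k \<in> Poly_Mapping.keys f")
       (auto simp: lookup_sum lookup_single when_def in_keys_iff)
qed

lemma poly_mapping_induct [case_names single add]:
  fixes f :: "'a \<Rightarrow>\<^sub>0 'b::comm_monoid_add"
  assumes single: "\<And>m c. P (Poly_Mapping.single m c)"
    and add: "\<And>f g. P f \<Longrightarrow> P g \<Longrightarrow> P (f + g)"
  shows "P f"
proof -
  have "P (\<Sum>m\<in>A. Poly_Mapping.single m (Poly_Mapping.lookup f m))" if "finite A" for A
    using that
  proof (induction A)
    case empty
    show ?case using single[of undefined 0] by simp
  qed (simp add: add single)
  then show ?thesis
    by (subst poly_mapping_sum_singles[of f]) simp
qed

lemma mon_eval_superset:
  assumes "finite A" "Poly_Mapping.keys m \<subseteq> A"
  shows "mon_eval y m = (\<Prod>i\<in>A. y i ^ Poly_Mapping.lookup m i)"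
  unfolding mon_eval_def
  by (rule prod.mono_neutral_left) (use assms in \<open>auto simp: in_keys_iff\<close>)

lemma mon_eval_add: "mon_eval y (m + n) = mon_eval y m * mon_eval y n"
proof -
  let ?A = "Poly_Mapping.keys m \<union> Poly_Mapping.keys n"
  have "Poly_Mapping.keys (m + n) \<subseteq> ?A" by (rule Poly_Mapping.keys_add)
  then show ?thesis
    by (simp add: mon_eval_superset[of ?A] lookup_add power_add prod.distrib)
qed

lemma poly_subst_superset:
  assumes "finite A" "Poly_Mapping.keys f \<subseteq> A"
  shows "poly_subst y f = (\<Sum>m\<in>A. cst (Poly_Mapping.lookup f m) * mon_eval y m)"
  unfolding poly_subst_def
  by (rule sum.mono_neutral_left) (use assms in \<open>auto simp: in_keys_iff\<close>)

lemma poly_subst_add: "poly_subst y (f + g) = poly_subst y f + poly_subst y g"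
proof -
  let ?A = "Poly_Mapping.keys f \<union> Poly_Mapping.keys g"
  have "Poly_Mapping.keys (f + g) \<subseteq> ?A" by (rule Poly_Mapping.keys_add)
  then show ?thesis
    by (simp add: poly_subst_superset[of ?A] lookup_add single_add distrib_right sum.distrib)
qed

lemma poly_subst_single: "poly_subst y (Poly_Mapping.single m c) = cst c * mon_eval y m"
  by (simp add: poly_subst_def)

lemma poly_subst_zero [simp]: "poly_subst y 0 = 0"
  by (simp add: poly_subst_def)

lemma poly_subst_mult: "poly_subst y (f * g) = poly_subst y f * poly_subst y g"
proof (induction f rule: poly_mapping_induct)
  case (single m c)
  show ?case
  proof (induction g rule: poly_mapping_induct)
    case (single n d)
    have "cst (c * d) = cst c * cst d" by (simp add: mult_single)
    then show ?case
      by (simp add: mult_single poly_subst_single mon_eval_add)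
  next
    case (add f g)
    then show ?case by (simp add: distrib_left poly_subst_add)
  qed
next
  case (add f g)
  then show ?case by (simp add: distrib_right poly_subst_add)
qed

lemma poly_subst_sum: "poly_subst y (sum f A) = (\<Sum>i\<in>A. poly_subst y (f i))"
  by (induction A rule: infinite_finite_induct) (simp_all add: poly_subst_add)

lemma var_power: "var i ^ k = Poly_Mapping.single (Poly_Mapping.single i k) 1"
  by (induction k) (simp_all add: mult_single single_add[symmetric] add.commute)

lemma prod_singles:
  "(\<Prod>i\<in>A. Poly_Mapping.single (g i) (1::complex)) = Poly_Mapping.single (\<Sum>i\<in>A. g i) 1"
  by (induction A rule: infinite_finite_induct) (simp_all add: mult_single)

lemma mon_eval_var: "mon_eval var m = Poly_Mapping.single m 1"
  unfolding mon_eval_def var_power prod_singles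
  by (simp only: poly_mapping_sum_singles[symmetric])

lemma poly_subst_var: "poly_subst var f = f"
  unfolding poly_subst_def mon_eval_var mult_single add_0_left mult_1_right
  by (rule poly_mapping_sum_singles[symmetric])

lemma dvd_diff_mult:
  fixes d :: "'a::comm_ring_1"
  assumes "d dvd a - b" "d dvd a' - b'"
  shows "d dvd a * a' - b * b'"
proof -
  have "a * a' - b * b' = (a - b) * a' + b * (a' - b')" by (simp add: algebra_simps)
  then show ?thesis using assms by simp
qed

lemma dvd_diff_power:
  fixes d :: "'a::comm_ring_1"
  assumes "d dvd a - b"
  shows "d dvd a ^ k - b ^ k"
  by (induction k) (simp_all add: dvd_diff_mult assms)

text \<open>
  Since \<open>poly_subst var\<close> is the identity, this compares a polynomial with its image under a
  substitution, modulo \<open>d\<close>.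
\<close>

lemma poly_subst_cong_mod:
  assumes "\<And>i. d dvd y i - z i"
  shows "d dvd poly_subst y f - poly_subst z f"
proof -
  have "d dvd (\<Prod>i\<in>A. y i ^ e i) - (\<Prod>i\<in>A. z i ^ e i)" for A and e :: "nat \<Rightarrow> nat"
    by (induction A rule: infinite_finite_induct) (simp_all add: dvd_diff_mult dvd_diff_power assms)
  then have mon: "d dvd mon_eval y m - mon_eval z m" for m
    unfolding mon_eval_def .
  have "poly_subst y f - poly_subst z f =
      (\<Sum>m\<in>Poly_Mapping.keys f. cst (Poly_Mapping.lookup f m) * (mon_eval y m - mon_eval z m))"
    by (simp add: poly_subst_def right_diff_distrib sum_subtractf)
  also have "d dvd \<dots>" by (intro dvd_sum dvd_mult mon)
  finally show ?thesis .
qed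

definition linear_form :: "nat \<Rightarrow> (nat \<Rightarrow> complex) \<Rightarrow> cpoly" where
  "linear_form n c = (\<Sum>i=1..n. Poly_Mapping.single (Poly_Mapping.single i 1) (c i))"

lemma lookup_linear_form:
  "Poly_Mapping.lookup (linear_form n c) (Poly_Mapping.single k 1) = (if k \<in> {1..n} then c k else 0)"
proof -
  have "Poly_Mapping.single i (1::nat) = Poly_Mapping.single k 1 \<longleftrightarrow> i = k" for i
    by (metis lookup_single_eq lookup_single_not_eq one_neq_zero)
  then show ?thesis
    by (simp add: linear_form_def lookup_sum lookup_single when_def)
qed

lemma linear_form_diff_scaled:
  "linear_form n (\<lambda>i. a i - t * c i) = linear_form n a - cst t * linear_form n c"
  by (simp add: linear_form_def sum_subtractf single_diff sum_distrib_left mult_single)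

lemma linear_form_alt: "linear_form n c = (\<Sum>i=1..n. cst (c i) * var i)"
  by (simp add: linear_form_def mult_single)

lemma poly_subst_linear_form:
  "poly_subst y (linear_form n c) = (\<Sum>i=1..n. cst (c i) * y i)"
  by (simp add: linear_form_def poly_subst_sum poly_subst_single mon_eval_def)

lemma cst_minus: "cst (- a) = - cst a"
  by (rule single_uminus)

text \<open>
  Solving \<open>\<Sum>\<^sub>i c\<^sub>i x\<^sub>i = 0\<close> for \<open>x\<^sub>k\<close> defines a substitution \<open>y\<close> that kills the linear form; it
  changes every polynomial only by a multiple of the form, because \<open>x\<^sub>k - y\<^sub>k\<close> is the form divided
  by \<open>c\<^sub>k\<close>.  So the ideal of the form is the kernel of an endomorphism of a domain, and is prime.
\<close>

lemma linear_form_elimination: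
  fixes c :: "nat \<Rightarrow> complex"
  assumes k: "k \<in> {1..n}" "c k \<noteq> 0"
  defines "y \<equiv> \<lambda>i. if i = k then cst (- (1 / c k)) * (\<Sum>j\<in>{1..n} - {k}. cst (c j) * var j) else var i"
  shows "linear_form n c dvd f \<longleftrightarrow> poly_subst y f = 0"
proof
  have split: "(\<Sum>i=1..n. h i) = h k + (\<Sum>i\<in>{1..n} - {k}. h i)" for h :: "nat \<Rightarrow> cpoly"
    using k by (simp add: sum.remove)
  have one: "cst (c k) * (cst (1 / c k) * g) = g" for g
    using k by (simp add: mult.assoc[symmetric] mult_single)
  have zero: "poly_subst y (linear_form n c) = 0"
  proof -
    have "(\<Sum>i\<in>{1..n} - {k}. cst (c i) * y i) = (\<Sum>i\<in>{1..n} - {k}. cst (c i) * var i)"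
      by (rule sum.cong) (auto simp: y_def)
    then show ?thesis
      unfolding poly_subst_linear_form by (subst split) (simp add: y_def cst_minus one)
  qed
  {
    assume "linear_form n c dvd f"
    then obtain h where "f = linear_form n c * h" ..
    then show "poly_subst y f = 0" by (simp add: poly_subst_mult zero)
  }
  assume f: "poly_subst y f = 0"
  have "cst (1 / c k) * linear_form n c = cst (1 / c k) * (cst (c k) * var k) + cst (1 / c k) * (\<Sum>j\<in>{1..n} - {k}. cst (c j) * var j)"
    unfolding linear_form_alt split distrib_left ..
  also have "\<dots> = var k - y k"
    unfolding mult.left_commute[of "cst (1 / c k)" "cst (c k)"] one by (simp add: y_def cst_minus)
  finally have "cst (1 / c k) * linear_form n c = var k - y k" .
  then have "linear_form n c dvd var k - y k" by (rule dvdI[OF sym[OF trans[OF mult.commute]]])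
  then have "linear_form n c dvd var i - y i" for i
    by (cases "i = k") (simp_all only: y_def if_False diff_self dvd_0_right)
  then have "linear_form n c dvd poly_subst var f - poly_subst y f"
    by (rule poly_subst_cong_mod)
  then show "linear_form n c dvd f" unfolding poly_subst_var f by simp
qed

lemma linear_form_prime:
  assumes "k \<in> {1..n}" "c k \<noteq> 0" "linear_form n c dvd f * g"
  shows "linear_form n c dvd f \<or> linear_form n c dvd g"
  using assms(3) unfolding linear_form_elimination[where k = k and n = n and c = c, OF assms(1,2)]
  by (simp add: poly_subst_mult)

text \<open>
  Eliminating \<open>x\<^sub>k\<close> turns the form \<open>a\<close> into \<open>a - (a\<^sub>k / c\<^sub>k) c\<close>, which has to vanish.
\<close>

lemma linear_form_dvd_linear_form:
  assumes k: "k \<in> {1..n}" "c k \<noteq> 0" and dvd: "linear_form n c dvd linear_form n a"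
    and i: "i \<in> {1..n}"
  shows "a i = a k / c k * c i"
proof -
  have split: "(\<Sum>i=1..n. h i) = h k + (\<Sum>i\<in>{1..n} - {k}. h i)" for h :: "nat \<Rightarrow> cpoly"
    using k by (simp add: sum.remove)
  define S where "S = (\<Sum>j\<in>{1..n} - {k}. cst (c j) * var j)"
  define y where "y = (\<lambda>i. if i = k then cst (- (1 / c k)) * S else var i)"
  define e where "e = (\<lambda>j. a j - a k / c k * c j)"
  have "poly_subst y (linear_form n a) = 0"
    using linear_form_elimination[where k = k and n = n and c = c and f = "linear_form n a"] k dvd
    unfolding y_def S_def by blast
  moreover have "poly_subst y (linear_form n a) = linear_form n e"
  proof -
    have 1: "(\<Sum>i\<in>{1..n} - {k}. cst (a i) * y i) = (\<Sum>i\<in>{1..n} - {k}. cst (a i) * var i)"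
      by (rule sum.cong) (auto simp: y_def)
    have "e k = 0" using k by (simp add: e_def)
    then have "linear_form n e = (\<Sum>j\<in>{1..n} - {k}. cst (e j) * var j)"
      unfolding linear_form_alt split by simp
    also have "\<dots> = (\<Sum>j\<in>{1..n} - {k}. cst (a j) * var j) - cst (a k / c k) * S"
      unfolding S_def sum_distrib_left sum_subtractf[symmetric]
      by (rule sum.cong) (simp_all add: e_def mult_single single_diff left_diff_distrib)
    finally have 2: "linear_form n e = (\<Sum>j\<in>{1..n} - {k}. cst (a j) * var j) - cst (a k / c k) * S" .
    have "cst (a k) * y k = - (cst (a k / c k) * S)"
      by (simp add: y_def mult.assoc[symmetric] mult_single cst_minus)
    then show ?thesis
      unfolding poly_subst_linear_form 2 split 1 by simp
  qed
  ultimately have "Poly_Mapping.lookup (linear_form n e) (Poly_Mapping.single i 1) = 0" by simp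
  then show ?thesis using i unfolding lookup_linear_form by (simp add: e_def)
qed

definition mdeg :: "(nat \<Rightarrow>\<^sub>0 nat) \<Rightarrow> nat" where
  "mdeg m = (\<Sum>i\<in>Poly_Mapping.keys m. Poly_Mapping.lookup m i)"

definition scale2 :: "cpoly \<Rightarrow> cpoly" where
  "scale2 = poly_subst (\<lambda>i. cst 2 * var i)"

lemma cst_power: "cst a ^ k = cst (a ^ k)"
  by (induction k) (simp_all add: mult_single)

lemma prod_cst: "(\<Prod>i\<in>A. cst (g i)) = cst (\<Prod>i\<in>A. g i)"
  by (induction A rule: infinite_finite_induct) (simp_all add: mult_single)

lemma scale2_single: "scale2 (Poly_Mapping.single m c) = Poly_Mapping.single m (2 ^ mdeg m * c)"
proof -
  have "mon_eval (\<lambda>i. cst 2 * var i) m = cst (2 ^ mdeg m) * mon_eval var m"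
    unfolding mon_eval_def mdeg_def power_mult_distrib prod.distrib cst_power prod_cst
    by (simp add: power_sum)
  then show ?thesis
    unfolding scale2_def poly_subst_single mon_eval_var
    by (simp add: mult_single mult.commute)
qed

lemma lookup_scale2: "Poly_Mapping.lookup (scale2 f) m = 2 ^ mdeg m * Poly_Mapping.lookup f m"
proof (induction f rule: poly_mapping_induct)
  case (single m c)
  then show ?case by (simp add: scale2_single lookup_single when_def)
next
  case (add f g)
  then show ?case by (simp add: scale2_def poly_subst_add lookup_add distrib_left)
qed

lemma lookup_cst_mult: "Poly_Mapping.lookup (cst c * f) m = c * Poly_Mapping.lookup f m"
  by (induction f rule: poly_mapping_induct)
     (auto simp: mult_single lookup_single when_def lookup_add distrib_left)

text \<open>
  The factor \<open>2\<close> may be any scalar whose powers are distinct.  Homogeneity becomes an eigenvalue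
  equation for a ring endomorphism, so degrees of products and of cofactors can be read off
  without decomposing polynomials into homogeneous parts.
\<close>

lemma homogeneous_iff_scale2: "homogeneous d f \<longleftrightarrow> scale2 f = cst (2 ^ d) * f"
proof -
  have "(2::complex) ^ a = 2 ^ d \<longleftrightarrow> a = d" for a :: nat
  proof -
    have "(2::complex) ^ a = 2 ^ d \<longleftrightarrow> (of_nat (2 ^ a) :: complex) = of_nat (2 ^ d)" by simp
    also have "\<dots> \<longleftrightarrow> a = d" unfolding of_nat_eq_iff by simp
    finally show ?thesis .
  qed
  then show ?thesis
    unfolding homogeneous_def mdeg_def[symmetric] poly_mapping_eq_iff fun_eq_iff
      lookup_scale2 lookup_cst_mult
    by (auto simp: in_keys_iff)
qed

lemma homogeneous_0 [simp]: "homogeneous d 0"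
  by (simp add: homogeneous_def)

lemma homogeneous_linear_form: "homogeneous 1 (linear_form n c)"
proof -
  have "scale2 (linear_form n c) =
      (\<Sum>i=1..n. scale2 (Poly_Mapping.single (Poly_Mapping.single i 1) (c i)))"
    by (simp add: scale2_def linear_form_def poly_subst_sum)
  also have "\<dots> = cst (2 ^ 1) * linear_form n c"
    unfolding linear_form_def sum_distrib_left mult_single scale2_single by (simp add: mdeg_def)
  finally show ?thesis by (simp only: homogeneous_iff_scale2)
qed

lemma homogeneous_mult: "homogeneous d f \<Longrightarrow> homogeneous e g \<Longrightarrow> homogeneous (d + e) (f * g)"
proof -
  assume *: "homogeneous d f" "homogeneous e g"
  have "scale2 (f * g) = cst (2 ^ d) * f * (cst (2 ^ e) * g)"
    using * by (simp add: homogeneous_iff_scale2 scale2_def poly_subst_mult)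
  also have "\<dots> = cst (2 ^ d) * cst (2 ^ e) * (f * g)" by (simp only: mult_ac)
  also have "cst (2 ^ d) * cst (2 ^ e) = cst (2 ^ (d + e))"
    by (simp add: mult_single power_add)
  finally show ?thesis by (simp only: homogeneous_iff_scale2)
qed

lemma homogeneous_diff: "homogeneous d f \<Longrightarrow> homogeneous d g \<Longrightarrow> homogeneous d (f - g)"
proof -
  assume *: "homogeneous d f" "homogeneous d g"
  have "poly_subst y (f - g) = poly_subst y f - poly_subst y g" for y
    by (metis add_diff_cancel_right' diff_add_cancel poly_subst_add)
  then show ?thesis
    using * unfolding homogeneous_iff_scale2 by (simp add: scale2_def right_diff_distrib)
qed

lemma homogeneous_unique: "homogeneous d f \<Longrightarrow> homogeneous e f \<Longrightarrow> f \<noteq> 0 \<Longrightarrow> d = e"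
  unfolding homogeneous_def by (metis all_not_in_conv keys_eq_empty)

text \<open>
  Applying \<open>scale2\<close> to \<open>f * h\<close> and cancelling \<open>f\<close> shows that \<open>h\<close> is an eigenvector of \<open>scale2\<close> for
  \<open>2\<^sup>d / 2\<^sup>e\<close>.
\<close>

lemma homogeneous_factor:
  assumes "homogeneous d (f * h)" "homogeneous e f" "f \<noteq> 0" "h \<noteq> 0"
  shows "e \<le> d \<and> homogeneous (d - e) h"
proof -
  have "f * (cst (2 ^ e) * scale2 h) = f * (cst (2 ^ d) * h)"
    using assms(1,2) unfolding homogeneous_iff_scale2
    by (simp add: scale2_def poly_subst_mult mult_ac)
  then have eq: "cst (2 ^ e) * scale2 h = cst (2 ^ d) * h"
    using assms(3) by simp
  have deg: "e + mdeg m = d" if "Poly_Mapping.lookup h m \<noteq> 0" for m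
  proof -
    have "(2::complex) ^ e * (2 ^ mdeg m * Poly_Mapping.lookup h m) = 2 ^ d * Poly_Mapping.lookup h m"
      using arg_cong[OF eq, of "\<lambda>p. Poly_Mapping.lookup p m"] by (simp add: lookup_cst_mult lookup_scale2)
    then have "(2::complex) ^ (e + mdeg m) = 2 ^ d" using that by (simp add: power_add)
    then have "(of_nat (2 ^ (e + mdeg m)) :: complex) = of_nat (2 ^ d)" by simp
    then show ?thesis unfolding of_nat_eq_iff by simp
  qed
  obtain m where "Poly_Mapping.lookup h m \<noteq> 0"
    using assms(4) by (metis poly_mapping_eqI lookup_zero)
  with deg have "e \<le> d" by force
  moreover have "homogeneous (d - e) h"
    unfolding homogeneous_def mdeg_def[symmetric] using deg by (force simp: in_keys_iff)
  ultimately show ?thesis by simp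
qed

section \<open>Reflection groups and words\<close>

lemma reflection_involution [simp]: "reflection a (reflection a x) = x"
  by (cases "a = 0") (simp_all add: reflection_def inner_diff_left)

lemma reflection_comp_self [simp]: "reflection a \<circ> reflection a = id"
  by (simp add: fun_eq_iff)

lemma inv_reflection [simp]: "inv (reflection a) = reflection a"
  by (rule inv_unique_comp[OF reflection_comp_self reflection_comp_self])

lemma bij_reflection: "bij (reflection a)"
  by (rule o_bij[OF reflection_comp_self reflection_comp_self])

lemma linear_reflection: "linear (reflection a)"
  by (rule linearI) (simp_all add: reflection_def inner_add_left algebra_simps add_divide_distrib)

lemma inner_reflection: "inner (reflection a x) (reflection a y) = inner x y"
  by (cases "a = 0")
     (simp_all add: reflection_def inner_diff_left inner_diff_right inner_commute field_simps)

lemma reflection_self [simp]: "reflection a a = - a"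
  by (cases "a = 0") (simp_all add: reflection_def scaleR_2)

lemma reflection_uminus [simp]: "reflection (- a) = reflection a"
  by (simp add: reflection_def fun_eq_iff)

lemma reflection_group_linear: "w \<in> reflection_group A \<Longrightarrow> linear w"
proof (induction rule: reflection_group.induct)
  case one then show ?case using linear_id by (simp add: id_def)
next
  case (step w a) then show ?case by (intro linear_compose linear_reflection)
qed

lemma reflection_group_inner: "w \<in> reflection_group A \<Longrightarrow> inner (w x) (w y) = inner x y"
  by (induction rule: reflection_group.induct) (simp_all add: inner_reflection)

lemma reflection_group_bij: "w \<in> reflection_group A \<Longrightarrow> bij w"
  by (induction rule: reflection_group.induct) (rule bij_id, rule bij_comp[OF _ bij_reflection])

lemma reflection_group_reflection: "a \<in> A \<Longrightarrow> reflection a \<in> reflection_group A"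
  using reflection_group.step[OF reflection_group.one, of a] by simp

lemma reflection_group_comp:
  "u \<in> reflection_group A \<Longrightarrow> w \<in> reflection_group A \<Longrightarrow> u \<circ> w \<in> reflection_group A"
  by (induction rule: reflection_group.induct) (simp_all add: comp_assoc reflection_group.step)

lemma reflection_group_inv: "w \<in> reflection_group A \<Longrightarrow> inv w \<in> reflection_group A"
proof (induction rule: reflection_group.induct)
  case one then show ?case unfolding inv_id by (rule reflection_group.one)
next
  case (step w a)
  have "inv (reflection a \<circ> w) = inv w \<circ> reflection a"
    using step by (simp add: o_inv_distrib bij_reflection reflection_group_bij)
  then show ?case
    using reflection_group_comp[OF step.IH reflection_group_reflection[OF step.hyps(2)]]
    by (simp only:)
qed

lemma reflection_group_mono:
  assumes "A \<subseteq> B" shows "reflection_group A \<subseteq> reflection_group B"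
proof
  fix w assume "w \<in> reflection_group A"
  then show "w \<in> reflection_group B"
  proof induction
    case one show ?case by (rule reflection_group.one)
  next
    case (step w a)
    then show ?case using assms by (blast intro: reflection_group.step)
  qed
qed

lemma reflection_conjugate:
  assumes "w \<in> reflection_group A"
  shows "reflection (w a) \<circ> w = w \<circ> reflection a"
  using linear_diff[OF reflection_group_linear[OF assms]]
    linear_scale[OF reflection_group_linear[OF assms]]
  by (simp add: fun_eq_iff reflection_def reflection_group_inner[OF assms])

lemma word_prod_simps [simp]:
  "word_prod R [] = id"
  "word_prod R (i # bs) = reflection (simple_root R i) \<circ> word_prod R bs"
  by (simp_all add: word_prod_def)

lemma word_prod_append: "word_prod R (as @ bs) = word_prod R as \<circ> word_prod R bs"
  by (induction as) (simp_all add: comp_assoc)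

lemma reflection_group_eq_words:
  "w \<in> reflection_group (simple_root R ` I) \<longleftrightarrow> (\<exists>bs. set bs \<subseteq> I \<and> word_prod R bs = w)"
proof
  assume "w \<in> reflection_group (simple_root R ` I)"
  then show "\<exists>bs. set bs \<subseteq> I \<and> word_prod R bs = w"
  proof induction
    case one show ?case by (rule exI[of _ "[]"]) simp
  next
    case (step w a)
    then obtain bs i where "set bs \<subseteq> I" "word_prod R bs = w" "i \<in> I" "a = simple_root R i" by auto
    then show ?case by (intro exI[of _ "i # bs"]) simp
  qed
next
  have "word_prod R bs \<in> reflection_group (simple_root R ` I)" if "set bs \<subseteq> I" for bs
    using that by (induction bs) (simp_all add: reflection_group.one reflection_group.step)
  then show "\<exists>bs. set bs \<subseteq> I \<and> word_prod R bs = w \<Longrightarrow> w \<in> reflection_group (simple_root R ` I)"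
    by blast
qed

section \<open>Positive roots, length and the exchange property\<close>

locale based_roots =
  fixes R :: "'v::real_inner root_data"
  assumes based: "based_root_system R"
begin

\<comment> \<open>The interval \<open>{1..rank R}\<close> has to keep its shape under simplification.\<close>
declare One_nat_def [simp del]

abbreviation "\<Delta> \<equiv> {1..rank R}"
abbreviation "\<alpha> \<equiv> simple_root R"
abbreviation "s i \<equiv> reflection (simple_root R i)"
abbreviation "word \<equiv> word_prod R"
abbreviation "len \<equiv> weyl_length R"

definition coord :: "nat \<Rightarrow> 'v \<Rightarrow> real" where
  "coord i b = representation (\<alpha> ` \<Delta>) b (\<alpha> i)"

lemma independent_simple: "independent (\<alpha> ` \<Delta>)"
  and inj_simple: "inj_on \<alpha> \<Delta>"
  and finite_roots: "finite (roots R)"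
  and zero_not_root: "0 \<notin> roots R"
  and simple_in_roots: "i \<in> \<Delta> \<Longrightarrow> \<alpha> i \<in> roots R"
  and reflection_root: "a \<in> roots R \<Longrightarrow> b \<in> roots R \<Longrightarrow> reflection a b \<in> roots R"
  and scaled_root: "a \<in> roots R \<Longrightarrow> c *\<^sub>R a \<in> roots R \<Longrightarrow> c = 1 \<or> c = - 1"
  and root_cases: "a \<in> roots R \<Longrightarrow> a \<in> pos_roots R \<or> a \<in> neg_roots R"
  using based unfolding based_root_system_def root_system_def by blast+

lemma coord_simple: "i \<in> \<Delta> \<Longrightarrow> k \<in> \<Delta> \<Longrightarrow> coord k (\<alpha> i) = (if k = i then 1 else 0)"
  unfolding coord_def using real_vector.representation_basis[OF independent_simple, of "\<alpha> i"]
    inj_simple by (auto dest: inj_onD)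

abbreviation "E \<equiv> span (\<alpha> ` \<Delta>)"

lemma coord_add: "x \<in> E \<Longrightarrow> y \<in> E \<Longrightarrow> coord k (x + y) = coord k x + coord k y"
  and coord_diff: "x \<in> E \<Longrightarrow> y \<in> E \<Longrightarrow> coord k (x - y) = coord k x - coord k y"
  and coord_uminus: "x \<in> E \<Longrightarrow> coord k (- x) = - coord k x"
  and coord_scale: "x \<in> E \<Longrightarrow> coord k (c *\<^sub>R x) = c * coord k x"
  unfolding coord_def
  by (simp_all add: real_vector.representation_add real_vector.representation_diff
      real_vector.representation_neg real_vector.representation_scale independent_simple)

lemma coord_sum:
  assumes "k \<in> \<Delta>"
  shows "coord k (\<Sum>i\<in>\<Delta>. c i *\<^sub>R \<alpha> i) = c k"
proof -
  have "coord k (\<Sum>i\<in>A. c i *\<^sub>R \<alpha> i) = (\<Sum>i\<in>A. c i * coord k (\<alpha> i))"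
    if "finite A" "A \<subseteq> \<Delta>" for A
    using that
  proof (induction A)
    case empty
    show ?case by (simp add: coord_def real_vector.representation_zero)
  next
    case (insert x A)
    then have "(\<Sum>i\<in>A. c i *\<^sub>R \<alpha> i) \<in> E" "\<alpha> x \<in> E"
      by (auto intro!: span_sum span_scale intro: span_base)
    then show ?case using insert by (simp add: coord_add coord_scale span_scale)
  qed
  then show ?thesis using assms by (simp add: coord_simple if_distrib cong: if_cong)
qed

lemma expand_coord: "b \<in> E \<Longrightarrow> (\<Sum>i\<in>\<Delta>. coord i b *\<^sub>R \<alpha> i) = b"
  using real_vector.sum_representation_eq[OF independent_simple, of b "\<alpha> ` \<Delta>"]
  by (simp add: coord_def sum.reindex[OF inj_simple] o_def)

lemma pos_rootsD: "b \<in> pos_roots R \<Longrightarrow> b \<in> roots R"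
  by (simp add: pos_roots_def)

lemma finite_pos_roots: "finite (pos_roots R)"
  using finite_subset[OF _ finite_roots, of "pos_roots R"] pos_rootsD by blast

lemma pos_root_coord:
  assumes "b \<in> pos_roots R"
  obtains c :: "nat \<Rightarrow> nat" where "\<And>i. i \<in> \<Delta> \<Longrightarrow> coord i b = real (c i)"
    "b = (\<Sum>i\<in>\<Delta>. real (c i) *\<^sub>R \<alpha> i)"
proof -
  obtain c :: "nat \<Rightarrow> nat" where c: "b = (\<Sum>i\<in>\<Delta>. real (c i) *\<^sub>R \<alpha> i)"
    using assms unfolding pos_roots_def by blast
  show ?thesis by (rule that[OF _ c]) (simp add: c coord_sum)
qed

lemma pos_root_coord_nonneg: "b \<in> pos_roots R \<Longrightarrow> i \<in> \<Delta> \<Longrightarrow> 0 \<le> coord i b"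
  by (metis of_nat_0_le_iff pos_root_coord)

lemma sum_simple_in_span: "(\<Sum>i\<in>\<Delta>. c i *\<^sub>R \<alpha> i) \<in> E"
  by (auto intro!: span_sum span_scale intro: span_base)

lemma root_in_span: "b \<in> roots R \<Longrightarrow> b \<in> E"
proof -
  have pos: "b \<in> E" if "b \<in> pos_roots R" for b
    using that by (metis pos_root_coord sum_simple_in_span)
  assume "b \<in> roots R"
  then show "b \<in> E"
    using pos root_cases[of b] unfolding neg_roots_def by (auto intro: span_neg)
qed

lemma span_eqI:
  assumes "a \<in> E" "b \<in> E" "\<And>i. i \<in> \<Delta> \<Longrightarrow> coord i a = coord i b"
  shows "a = b"
proof -
  have "(\<Sum>i\<in>\<Delta>. coord i a *\<^sub>R \<alpha> i) = (\<Sum>i\<in>\<Delta>. coord i b *\<^sub>R \<alpha> i)"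
    by (rule sum.cong) (simp_all add: assms)
  then show ?thesis by (simp only: expand_coord[OF assms(1)] expand_coord[OF assms(2)])
qed

lemma root_coord_nonzero:
  assumes "b \<in> roots R" obtains k where "k \<in> \<Delta>" "coord k b \<noteq> 0"
proof -
  have "\<exists>k\<in>\<Delta>. coord k b \<noteq> 0"
  proof (rule ccontr)
    assume "\<not> ?thesis"
    then have "(\<Sum>i\<in>\<Delta>. coord i b *\<^sub>R \<alpha> i) = 0" by simp
    then show False using expand_coord[OF root_in_span[OF assms]] assms zero_not_root by simp
  qed
  then show ?thesis using that by blast
qed

lemma neg_iff: "b \<in> neg_roots R \<longleftrightarrow> - b \<in> pos_roots R"
  unfolding neg_roots_def by force

lemma pos_not_neg: "b \<in> pos_roots R \<Longrightarrow> b \<notin> neg_roots R"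
proof
  assume b: "b \<in> pos_roots R" and "b \<in> neg_roots R"
  then have m: "- b \<in> pos_roots R" by (simp add: neg_iff)
  obtain k where "k \<in> \<Delta>" "coord k b \<noteq> 0" using root_coord_nonzero[OF pos_rootsD[OF b]] .
  then show False
    using pos_root_coord_nonneg[OF b, of k] pos_root_coord_nonneg[OF m, of k]
      coord_uminus[OF root_in_span[OF pos_rootsD[OF b]]] by simp
qed

lemma not_pos_iff: "b \<in> roots R \<Longrightarrow> b \<notin> pos_roots R \<longleftrightarrow> b \<in> neg_roots R"
  using root_cases pos_not_neg by blast

lemma not_neg_iff: "b \<in> roots R \<Longrightarrow> b \<notin> neg_roots R \<longleftrightarrow> b \<in> pos_roots R"
  using root_cases pos_not_neg by blast

lemma neg_uminus_iff: "- b \<in> neg_roots R \<longleftrightarrow> b \<in> pos_roots R"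
  by (simp add: neg_iff)

lemma simple_pos: "i \<in> \<Delta> \<Longrightarrow> \<alpha> i \<in> pos_roots R"
proof -
  assume i: "i \<in> \<Delta>"
  have "\<alpha> i \<notin> neg_roots R"
  proof
    assume "\<alpha> i \<in> neg_roots R"
    then have "- \<alpha> i \<in> pos_roots R" by (simp add: neg_iff)
    then have "0 \<le> coord i (- \<alpha> i)" using i pos_root_coord_nonneg by blast
    then show False
      using i coord_uminus[OF root_in_span[OF simple_in_roots[OF i]], of i] by (simp add: coord_simple)
  qed
  then show ?thesis using not_neg_iff simple_in_roots i by blast
qed

lemma coord_reflection_simple:
  assumes "i \<in> \<Delta>" "b \<in> E" "k \<in> \<Delta>"
  shows "coord k (s i b) = coord k b - (if k = i then 2 * inner b (\<alpha> i) / inner (\<alpha> i) (\<alpha> i) else 0)"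
proof -
  have "\<alpha> i \<in> E" using assms by (auto intro: span_base)
  then show ?thesis
    unfolding reflection_def using assms by (simp add: coord_diff coord_scale span_scale coord_simple)
qed

text \<open>
  A positive root \<open>b \<noteq> \<alpha>\<^sub>i\<close> has a positive coordinate at some \<open>k \<noteq> i\<close>, as the only positive
  multiple of \<open>\<alpha>\<^sub>i\<close> among the roots is \<open>\<alpha>\<^sub>i\<close>; the reflection does not change that coordinate, and one
  positive coordinate excludes negative roots.
\<close>

lemma simple_reflection_pos:
  assumes i: "i \<in> \<Delta>" and b: "b \<in> pos_roots R" "b \<noteq> \<alpha> i"
  shows "s i b \<in> pos_roots R"
proof (rule ccontr)
  assume n: "s i b \<notin> pos_roots R"
  have br: "b \<in> roots R" using b pos_rootsD by blast
  then have r: "s i b \<in> roots R" using i simple_in_roots reflection_root by blast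
  then have m: "- s i b \<in> pos_roots R" using n not_pos_iff by (simp add: neg_iff)
  have "coord k b = 0" if "k \<in> \<Delta>" "k \<noteq> i" for k
    using that pos_root_coord_nonneg[OF b(1) that(1)] pos_root_coord_nonneg[OF m that(1)]
    coord_uminus[OF root_in_span[OF r], of k] coord_reflection_simple[OF i root_in_span[OF br] that(1)]
    by simp
  then have "(\<Sum>k\<in>\<Delta>. coord k b *\<^sub>R \<alpha> k) = (\<Sum>k\<in>\<Delta>. if k = i then coord i b *\<^sub>R \<alpha> i else 0)"
    by (intro sum.cong) auto
  then have "b = coord i b *\<^sub>R \<alpha> i"
    using i expand_coord[OF root_in_span[OF br]] by simp
  moreover from this have "coord i b = 1 \<or> coord i b = -1"
    using scaled_root[OF simple_in_roots[OF i]] br by metis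
  moreover have "0 \<le> coord i b" using pos_root_coord_nonneg[OF b(1) i] .
  ultimately have "b = \<alpha> i" by auto
  then show False using b by simp
qed

text \<open>
  Induction on the height.  As \<open>\<langle>b, b\<rangle> > 0\<close>, some simple root has a positive inner product with
  \<open>b\<close>.  Reflecting in it lowers the height, and conjugates the reflection in \<open>b\<close>.
\<close>

lemma reflection_pos_is_word:
  assumes "b \<in> pos_roots R"
  shows "\<exists>bs. set bs \<subseteq> \<Delta> \<and> word bs = reflection b"
proof -
  have height: "\<exists>h::nat. (\<Sum>i\<in>\<Delta>. coord i b) = real h" if b: "b \<in> pos_roots R" for b
  proof -
    obtain c :: "nat \<Rightarrow> nat" where "\<And>i. i \<in> \<Delta> \<Longrightarrow> coord i b = real (c i)"
      using pos_root_coord[OF b] by metis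
    then have "(\<Sum>i\<in>\<Delta>. coord i b) = real (\<Sum>i\<in>\<Delta>. c i)" by simp
    then show ?thesis ..
  qed
  have "\<exists>bs. set bs \<subseteq> \<Delta> \<and> word bs = reflection b"
    if "b \<in> pos_roots R" "(\<Sum>i\<in>\<Delta>. coord i b) = real h" for h b
    using that
  proof (induction h arbitrary: b rule: less_induct)
    case (less h)
    have br: "b \<in> roots R" using less pos_rootsD by blast
    have "0 < inner b b" using br zero_not_root by auto
    also have "inner b b = inner b (\<Sum>i\<in>\<Delta>. coord i b *\<^sub>R \<alpha> i)"
      using expand_coord[OF root_in_span[OF br]] by simp
    also have "\<dots> = (\<Sum>i\<in>\<Delta>. coord i b * inner b (\<alpha> i))"
      by (simp add: inner_sum_right)
    finally obtain i where i: "i \<in> \<Delta>" "0 < coord i b * inner b (\<alpha> i)"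
      by (meson not_less sum_nonpos)
    then have ip: "0 < inner b (\<alpha> i)"
      using pos_root_coord_nonneg[OF less.prems(1) i(1)] by (auto simp: zero_less_mult_iff)
    show ?case
    proof (cases "b = \<alpha> i")
      case True
      then show ?thesis using i by (intro exI[of _ "[i]"]) simp
    next
      case False
      let ?c = "s i b"
      have c: "?c \<in> pos_roots R" using simple_reflection_pos[OF i(1) less.prems(1) False] .
      obtain h' where h': "(\<Sum>k\<in>\<Delta>. coord k ?c) = real h'" using height[OF c] by blast
      have "inner (\<alpha> i) (\<alpha> i) > 0" using simple_in_roots[OF i(1)] zero_not_root by auto
      then have "0 < 2 * inner b (\<alpha> i) / inner (\<alpha> i) (\<alpha> i)" using ip by simp
      moreover have "(\<Sum>k\<in>\<Delta>. coord k ?c) = real h - 2 * inner b (\<alpha> i) / inner (\<alpha> i) (\<alpha> i)"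
        using i less.prems(2)
        by (simp add: coord_reflection_simple root_in_span[OF br] sum_subtractf)
      ultimately have "h' < h" using h' by simp
      then obtain bs where bs: "set bs \<subseteq> \<Delta>" "word bs = reflection ?c"
        using less.IH c h' by blast
      have "reflection (s i ?c) \<circ> s i = s i \<circ> reflection ?c"
        by (rule reflection_conjugate) (rule reflection_group_reflection, rule singletonI)
      then have "s i \<circ> reflection ?c \<circ> s i = reflection b"
        by (metis comp_assoc comp_id reflection_comp_self reflection_involution)
      then have "word (i # bs @ [i]) = reflection b"
        using bs by (simp add: word_prod_append comp_assoc)
      then show ?thesis using bs i by (intro exI[of _ "i # bs @ [i]"]) auto
    qed
  qed
  then show ?thesis using assms height by blast
qed

lemma weyl_eq_simple: "weyl R = reflection_group (\<alpha> ` \<Delta>)"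
proof
  show "reflection_group (\<alpha> ` \<Delta>) \<subseteq> weyl R"
    unfolding weyl_def by (rule reflection_group_mono) (use simple_in_roots in blast)
  show "weyl R \<subseteq> reflection_group (\<alpha> ` \<Delta>)"
  proof
    fix w assume "w \<in> weyl R"
    then show "w \<in> reflection_group (\<alpha> ` \<Delta>)"
      unfolding weyl_def
    proof induction
      case one show ?case by (rule reflection_group.one)
    next
      case (step w a)
      have "\<exists>b. b \<in> pos_roots R \<and> reflection b = reflection a"
        using root_cases[OF step.hyps(2)] by (metis neg_iff reflection_uminus)
      then have "reflection a \<in> reflection_group (\<alpha> ` \<Delta>)"
        using reflection_pos_is_word reflection_group_eq_words by metis
      then show ?case using step.IH by (rule reflection_group_comp)
    qed
  qed
qed

lemma weyl_eq_words: "w \<in> weyl R \<longleftrightarrow> (\<exists>bs. set bs \<subseteq> \<Delta> \<and> word bs = w)"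
  unfolding weyl_eq_simple by (rule reflection_group_eq_words)

lemma id_weyl: "id \<in> weyl R"
  unfolding weyl_def by (rule reflection_group.one)

lemma comp_weyl: "u \<in> weyl R \<Longrightarrow> w \<in> weyl R \<Longrightarrow> u \<circ> w \<in> weyl R"
  unfolding weyl_def by (rule reflection_group_comp)

lemma reflection_weyl: "a \<in> roots R \<Longrightarrow> reflection a \<in> weyl R"
  unfolding weyl_def by (rule reflection_group_reflection)

lemma inv_weyl: "w \<in> weyl R \<Longrightarrow> inv w \<in> weyl R"
  unfolding weyl_def by (rule reflection_group_inv)

lemma bij_weyl: "w \<in> weyl R \<Longrightarrow> bij w"
  unfolding weyl_def by (rule reflection_group_bij)

lemma inv_cancel: "w \<in> weyl R \<Longrightarrow> inv w (w x) = x" "w \<in> weyl R \<Longrightarrow> w (inv w x) = x"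
  using bij_weyl by (auto simp: bij_is_inj bij_is_surj surj_f_inv_f)

lemma weyl_uminus: "w \<in> weyl R \<Longrightarrow> w (- x) = - w x"
  unfolding weyl_def by (rule linear_neg[OF reflection_group_linear])

lemma weyl_conjugate: "w \<in> weyl R \<Longrightarrow> reflection (w a) \<circ> w = w \<circ> reflection a"
  unfolding weyl_def by (rule reflection_conjugate)

lemma weyl_root: "w \<in> weyl R \<Longrightarrow> a \<in> roots R \<Longrightarrow> w a \<in> roots R"
  unfolding weyl_def
  by (induction arbitrary: a rule: reflection_group.induct) (auto intro: reflection_root)

lemma simple_weyl: "i \<in> \<Delta> \<Longrightarrow> s i \<in> weyl R"
  by (simp add: simple_in_roots reflection_weyl)

lemma word_weyl: "set bs \<subseteq> \<Delta> \<Longrightarrow> word bs \<in> weyl R"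
  using weyl_eq_words by blast

lemma inv_reflection_comp: "w \<in> weyl R \<Longrightarrow> inv (reflection a \<circ> w) = inv w \<circ> reflection a"
  by (simp add: o_inv_distrib bij_reflection bij_weyl)

lemma inv_comp_reflection: "w \<in> weyl R \<Longrightarrow> inv (w \<circ> reflection a) = reflection a \<circ> inv w"
  by (simp add: o_inv_distrib bij_reflection bij_weyl)

text \<open>
  Strip letters from the left while \<open>a\<close>, reflected in each of them, stays positive.  Since the whole
  word makes it negative, at some letter it equals the simple root of that letter, the only positive
  root that this letter makes negative.  Reflecting in \<open>a\<close> amounts to deleting that letter.  The set
  \<open>I\<close> of admissible letters is kept so that the result can be used inside parabolic subgroups.
\<close>

lemma exchange:
  assumes "set bs \<subseteq> I" "I \<subseteq> \<Delta>" "a \<in> pos_roots R" "inv (word bs) a \<in> neg_roots R"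
  shows "\<exists>cs. set cs \<subseteq> I \<and> length cs < length bs \<and> word cs = reflection a \<circ> word bs"
  using assms
proof (induction bs arbitrary: a)
  case Nil
  then show ?case using pos_not_neg by simp
next
  case (Cons i bs)
  have i: "i \<in> \<Delta>" and w: "word bs \<in> weyl R" and bsI: "set bs \<subseteq> I"
    using Cons.prems word_weyl[of bs] by auto
  show ?case
  proof (cases "a = \<alpha> i")
    case True
    then have "word bs = reflection a \<circ> word (i # bs)" by (simp add: comp_assoc[symmetric])
    moreover have "set bs \<subseteq> I" "length bs < length (i # bs)" using Cons.prems(1) by simp_all
    ultimately show ?thesis by blast
  next
    case False
    let ?b = "s i a"
    have "?b \<in> pos_roots R" using simple_reflection_pos[OF i Cons.prems(3) False] .
    moreover have "inv (word bs) ?b \<in> neg_roots R"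
      using Cons.prems(4) unfolding word_prod_simps inv_reflection_comp[OF w] by simp
    ultimately obtain cs where cs: "set cs \<subseteq> I" "length cs < length bs"
      "word cs = reflection ?b \<circ> word bs"
      using Cons.IH[of ?b] bsI Cons.prems(2) by blast
    have "reflection (s i ?b) \<circ> s i = s i \<circ> reflection ?b"
      by (rule weyl_conjugate[OF simple_weyl[OF i]])
    then have "word (i # cs) = reflection a \<circ> word (i # bs)"
      using cs by (simp add: comp_assoc[symmetric])
    then show ?thesis using cs Cons.prems(1) by (intro exI[of _ "i # cs"]) simp
  qed
qed

lemma len_word_le: "set bs \<subseteq> \<Delta> \<Longrightarrow> len (word bs) \<le> length bs"
  unfolding weyl_length_def is_word_def by (rule Least_le) blast

lemma reduced_word_exists:
  assumes "w \<in> weyl R"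
  obtains bs where "set bs \<subseteq> \<Delta>" "word bs = w" "length bs = len w"
proof -
  have "\<exists>k bs. is_word R bs w \<and> length bs = k"
    using assms weyl_eq_words unfolding is_word_def by blast
  then have "\<exists>bs. is_word R bs w \<and> length bs = len w"
    unfolding weyl_length_def by (rule LeastI_ex)
  then show ?thesis using that unfolding is_word_def by blast
qed

lemma len_id [simp]: "len id = 0"
  using len_word_le[of "[]"] by simp

lemma len_eq_0: "w \<in> weyl R \<Longrightarrow> len w = 0 \<longleftrightarrow> w = id"
  by (metis len_id length_0_conv reduced_word_exists word_prod_simps(1))

lemma len_reflection_less:
  assumes "w \<in> weyl R" "a \<in> pos_roots R" "inv w a \<in> neg_roots R"
  shows "len (reflection a \<circ> w) < len w"
proof -
  obtain bs where bs: "set bs \<subseteq> \<Delta>" "word bs = w" "length bs = len w"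
    using reduced_word_exists[OF assms(1)] .
  then obtain cs where "set cs \<subseteq> \<Delta>" "length cs < length bs" "word cs = reflection a \<circ> w"
    using exchange[of bs \<Delta> a] assms by auto
  then show ?thesis using len_word_le[of cs] bs by simp
qed

lemma len_simple_less:
  assumes w: "w \<in> weyl R" and i: "i \<in> \<Delta>" and n: "w (\<alpha> i) \<in> neg_roots R"
  shows "len (w \<circ> s i) < len w"
proof -
  \<comment> \<open>\<open>- w(\<alpha>\<^sub>i)\<close> is an inversion of \<open>w\<close>, and reflecting in it on the left is \<open>s\<^sub>i\<close> on the right.\<close>
  have "inv w (- w (\<alpha> i)) = - \<alpha> i"
    using w inv_cancel weyl_uminus by metis
  then have "len (reflection (- w (\<alpha> i)) \<circ> w) < len w"
    using n i simple_pos by (intro len_reflection_less w) (auto simp: neg_iff)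
  then show ?thesis using weyl_conjugate[OF w, of "\<alpha> i"] by simp
qed

lemma comp_simple_cancel [simp]: "w \<circ> s i \<circ> s i = w"
  by (simp add: comp_assoc)

lemma len_simple_le: "w \<in> weyl R \<Longrightarrow> i \<in> \<Delta> \<Longrightarrow> len (w \<circ> s i) \<le> Suc (len w)"
proof -
  assume "w \<in> weyl R" "i \<in> \<Delta>"
  moreover then obtain bs where "set bs \<subseteq> \<Delta>" "word bs = w" "length bs = len w"
    using reduced_word_exists by metis
  ultimately show ?thesis
    using len_word_le[of "bs @ [i]"] by (simp add: word_prod_append)
qed

lemma len_simple:
  assumes w: "w \<in> weyl R" and i: "i \<in> \<Delta>"
  shows len_simple_pos: "w (\<alpha> i) \<in> pos_roots R \<Longrightarrow> len (w \<circ> s i) = Suc (len w)"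
    and len_simple_neg: "w (\<alpha> i) \<in> neg_roots R \<Longrightarrow> Suc (len (w \<circ> s i)) = len w"
proof -
  have ws: "w \<circ> s i \<in> weyl R" using w i by (intro comp_weyl simple_weyl)
  {
    assume "w (\<alpha> i) \<in> neg_roots R"
    then show "Suc (len (w \<circ> s i)) = len w"
      using len_simple_less[OF w i] len_simple_le[OF ws i] by simp
  }
  assume p: "w (\<alpha> i) \<in> pos_roots R"
  have "(w \<circ> s i) (\<alpha> i) \<in> neg_roots R" using p w by (simp add: weyl_uminus neg_iff)
  then have "len w < len (w \<circ> s i)" using len_simple_less[OF ws i] by simp
  then show "len (w \<circ> s i) = Suc (len w)" using len_simple_le[OF w i] by simp
qed

definition inversions :: "('v \<Rightarrow> 'v) \<Rightarrow> 'v set" where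
  "inversions w = {a \<in> pos_roots R. inv w a \<in> neg_roots R}"

lemma finite_inversions [simp]: "finite (inversions w)"
  unfolding inversions_def using finite_pos_roots by simp

lemma simple_reflection_neg_iff:
  assumes "c \<in> roots R" "i \<in> \<Delta>"
  shows "s i c \<in> neg_roots R \<longleftrightarrow> c = \<alpha> i \<or> c \<in> neg_roots R \<and> c \<noteq> - \<alpha> i"
proof -
  consider "c = \<alpha> i" | "c = - \<alpha> i" | "c \<in> pos_roots R" "c \<noteq> \<alpha> i"
    | "c \<in> neg_roots R" "c \<noteq> - \<alpha> i"
    using root_cases[OF assms(1)] by blast
  then show ?thesis
  proof cases
    case 1 then show ?thesis using simple_pos[OF assms(2)] by (simp add: neg_iff)
  next
    case 2
    have "s i (- \<alpha> i) = \<alpha> i" by (metis reflection_involution reflection_self)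
    then show ?thesis using 2 simple_pos[OF assms(2)] pos_not_neg by (metis neg_uminus_iff)
  next
    case 3
    then show ?thesis using simple_reflection_pos[OF assms(2)] pos_not_neg by blast
  next
    case 4
    then have "- c \<in> pos_roots R" "- c \<noteq> \<alpha> i" by (auto simp: neg_iff minus_equation_iff[of c])
    then have "s i (- c) \<in> pos_roots R" by (rule simple_reflection_pos[OF assms(2)])
    then show ?thesis
      using 4 by (simp add: neg_iff weyl_uminus[OF simple_weyl[OF assms(2)]])
  qed
qed

text \<open>
  The simple reflection changes the sign of \<open>w\<^sup>-\<^sup>1 b\<close> only if this is \<open>\<plusminus>\<alpha>\<^sub>i\<close>.
\<close>

lemma inversions_comp_simple:
  assumes w: "w \<in> weyl R" and i: "i \<in> \<Delta>" and p: "w (\<alpha> i) \<in> pos_roots R"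
  shows "inversions (w \<circ> s i) = insert (w (\<alpha> i)) (inversions w)" "w (\<alpha> i) \<notin> inversions w"
proof -
  have root: "inv w b \<in> roots R" if "b \<in> pos_roots R" for b
    using that w by (simp add: weyl_root inv_weyl pos_rootsD)
  have eq: "inv w b = \<alpha> i \<longleftrightarrow> b = w (\<alpha> i)" for b using w inv_cancel by metis
  have "inv w b \<noteq> - \<alpha> i" if "b \<in> pos_roots R" for b
    using that p w by (metis inv_cancel(2) neg_uminus_iff pos_not_neg weyl_uminus)
  then show "inversions (w \<circ> s i) = insert (w (\<alpha> i)) (inversions w)"
    using p unfolding inversions_def inv_comp_reflection[OF w]
    by (auto simp: simple_reflection_neg_iff[OF root i] eq)
  show "w (\<alpha> i) \<notin> inversions w"
    using simple_pos[OF i] pos_not_neg by (simp add: inversions_def inv_cancel[OF w])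
qed

lemma inversions_id: "inversions id = {}"
  using pos_not_neg by (auto simp: inversions_def)

text \<open>
  Along a reduced word every letter adds exactly one inversion: a letter that removed one would
  shorten the element.
\<close>

lemma card_inversions: "w \<in> weyl R \<Longrightarrow> card (inversions w) = len w"
proof (induction "len w" arbitrary: w)
  case 0
  then show ?case using len_eq_0 by (metis card.empty inversions_id)
next
  case (Suc n)
  obtain cs where cs: "set cs \<subseteq> \<Delta>" "word cs = w" "length cs = len w"
    using reduced_word_exists[OF Suc.prems] .
  then obtain bs i where b: "cs = bs @ [i]"
    using Suc.hyps(2) by (metis length_0_conv nat.distinct(1) rev_exhaust)
  let ?u = "word bs"
  have u: "?u \<in> weyl R" and i: "i \<in> \<Delta>" and w: "w = ?u \<circ> s i" and le: "len ?u \<le> n"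
    using cs b Suc.hyps(2) word_weyl[of bs] len_word_le[of bs] by (auto simp: word_prod_append)
  have "?u (\<alpha> i) \<notin> neg_roots R"
    using len_simple_neg[OF u i] w le Suc.hyps(2) by auto
  then have p: "?u (\<alpha> i) \<in> pos_roots R"
    using not_neg_iff u i weyl_root simple_in_roots by blast
  then have "len w = Suc (len ?u)" using len_simple_pos[OF u i] w by simp
  then show ?case
    using Suc.hyps(1)[of ?u] Suc.hyps(2) inversions_comp_simple[OF u i p] u w by simp
qed

section \<open>Roots as linear forms\<close>

lemma lin_eq: "lin R b = linear_form (rank R) (\<lambda>i. complex_of_real (coord i b))"
  by (simp add: lin_def linear_form_def coord_def)

lemma homogeneous_lin: "homogeneous 1 (lin R b)"
  unfolding lin_eq by (rule homogeneous_linear_form)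

lemma lin_nonzero: assumes "b \<in> roots R" shows "lin R b \<noteq> 0"
proof
  assume *: "lin R b = 0"
  obtain k where "k \<in> \<Delta>" "coord k b \<noteq> 0" using root_coord_nonzero[OF assms] .
  then show False
    using lookup_linear_form[of "rank R" "\<lambda>i. complex_of_real (coord i b)" k] *
    unfolding lin_eq by simp
qed

lemma lin_diff_scaled:
  assumes "x \<in> E" "y \<in> E"
  shows "lin R (x - t *\<^sub>R y) = lin R x - cst (complex_of_real t) * lin R y"
  unfolding lin_eq linear_form_diff_scaled[symmetric]
  using assms by (simp add: coord_diff coord_scale span_scale)

lemma lin_uminus: "b \<in> roots R \<Longrightarrow> lin R (- b) = - lin R b"
  using lin_diff_scaled[of b b 2] root_in_span[of b] by (simp add: scaleR_2)

lemma lin_dvd_lin_reflection: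
  assumes "b \<in> roots R" "c \<in> roots R"
  shows "lin R b dvd lin R (reflection b c) - lin R c"
  using assms unfolding reflection_def by (simp add: lin_diff_scaled root_in_span)

lemma lin_prime:
  assumes "b \<in> roots R" "lin R b dvd f * g"
  shows "lin R b dvd f \<or> lin R b dvd g"
proof -
  obtain k where k: "k \<in> \<Delta>" "coord k b \<noteq> 0" using root_coord_nonzero[OF assms(1)] .
  show ?thesis
    unfolding lin_eq
    by (rule linear_form_prime[OF k(1)]) (use k assms(2) in \<open>simp_all add: lin_eq\<close>)
qed

lemma lin_dvd_lin:
  assumes a: "a \<in> roots R" and b: "b \<in> roots R" and dvd: "lin R b dvd lin R a"
  shows "a = b \<or> a = - b"
proof -
  obtain k where k: "k \<in> \<Delta>" "coord k b \<noteq> 0" using root_coord_nonzero[OF b] .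
  define t where "t = coord k a / coord k b"
  have "coord i a = t * coord i b" if "i \<in> \<Delta>" for i
  proof -
    have "complex_of_real (coord i a) =
        complex_of_real (coord k a) / complex_of_real (coord k b) * complex_of_real (coord i b)"
      by (rule linear_form_dvd_linear_form[OF k(1) _ _ that])
         (use k dvd in \<open>simp_all add: lin_eq\<close>)
    then have "complex_of_real (coord i a) = complex_of_real (t * coord i b)"
      by (simp add: t_def)
    then show ?thesis unfolding of_real_eq_iff .
  qed
  then have "a = t *\<^sub>R b"
    by (intro span_eqI) (simp_all add: root_in_span a b span_scale coord_scale)
  then show ?thesis using scaled_root[OF b, of t] a by auto
qed

lemma lin_dvd_prod_lin:
  assumes "a \<in> roots R" "finite A" "A \<subseteq> roots R" "lin R a dvd (\<Prod>b\<in>A. lin R b)"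
  shows "\<exists>b\<in>A. lin R a dvd lin R b"
  using assms(2-4)
proof (induction A)
  case empty
  have "\<exists>k. (1::cpoly) = lin R a * k" using empty by (auto simp: dvd_def)
  then obtain h where h: "lin R a * h = 1" by metis
  have "homogeneous 0 (1::cpoly)" by (simp add: homogeneous_def)
  then show ?case
    using homogeneous_factor[of 0 "lin R a" h 1] homogeneous_lin[of a] lin_nonzero[OF assms(1)] h
    by (metis mult_zero_right not_one_le_zero one_neq_zero)
next
  case (insert b A)
  then have "lin R a dvd lin R b \<or> lin R a dvd (\<Prod>b\<in>A. lin R b)"
    using lin_prime[OF assms(1)] by simp
  then show ?case using insert by auto
qed

text \<open>
  Distinct positive roots are not proportional, so their linear forms are non-associate primes.
\<close>

lemma prod_lin_dvd:
  assumes "finite A" "A \<subseteq> pos_roots R" "\<And>a. a \<in> A \<Longrightarrow> lin R a dvd f"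
  shows "(\<Prod>a\<in>A. lin R a) dvd f"
  using assms
proof (induction A)
  case (insert a A)
  then obtain h where h: "f = (\<Prod>a\<in>A. lin R a) * h" by (auto simp: dvd_def)
  have a: "a \<in> roots R" and A: "A \<subseteq> roots R" using insert.prems pos_rootsD by auto
  have "\<not> lin R a dvd (\<Prod>a\<in>A. lin R a)"
  proof
    assume "lin R a dvd (\<Prod>a\<in>A. lin R a)"
    then obtain b where b: "b \<in> A" "lin R a dvd lin R b"
      using lin_dvd_prod_lin[OF a insert.hyps(1) A] by blast
    then have "b = a \<or> b = - a" using lin_dvd_lin a A by blast
    then show False
      using b(1) insert.hyps(2) insert.prems(1) pos_not_neg[of a] by (auto simp: neg_iff)
  qed
  then have "lin R a dvd h" using lin_prime[OF a] insert.prems(2)[of a] h by blast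
  then show ?case using insert.hyps unfolding h by (simp add: mult.commute mult_dvd_mono)
qed simp

lemma homogeneous_prod_lin: "homogeneous (card A) (\<Prod>a\<in>A. lin R a)"
proof (induction A rule: infinite_finite_induct)
  case (insert a A)
  then show ?case using homogeneous_mult[OF homogeneous_lin, of "card A" _ a] by (simp add: plus_1_eq_Suc)
qed (simp_all add: homogeneous_def)

lemma prod_lin_nonzero: "A \<subseteq> roots R \<Longrightarrow> finite A \<Longrightarrow> (\<Prod>a\<in>A. lin R a) \<noteq> 0"
  using lin_nonzero by (auto simp: prod_zero_iff)

section \<open>Divisibility conditions and divided differences\<close>

text \<open>
  The divisibility conditions for a function on \<open>W\<close> itself.  A class of \<open>G/P\<close> gives one by pulling
  back along \<open>W \<rightarrow> W/W\<^sub>J\<close>.  Divisibility is that of the full polynomial ring, so that quotients need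
  not be tracked inside \<open>S(\<tt>\<^sup>*)\<close>.
\<close>

definition gkm :: "(('v \<Rightarrow> 'v) \<Rightarrow> cpoly) \<Rightarrow> bool" where
  "gkm f \<longleftrightarrow> (\<forall>v\<in>weyl R. \<forall>a\<in>pos_roots R. lin R a dvd f (reflection a \<circ> v) - f v)"

lemma gkm_root:
  assumes "gkm f" "v \<in> weyl R" "a \<in> roots R"
  shows "lin R a dvd f (reflection a \<circ> v) - f v"
proof (cases "a \<in> pos_roots R")
  case True then show ?thesis using assms by (simp add: gkm_def)
next
  case False
  then have "- a \<in> pos_roots R" using assms not_pos_iff neg_iff by blast
  then have "lin R (- a) dvd f (reflection (- a) \<circ> v) - f v" using assms unfolding gkm_def by blast
  then show ?thesis using assms by (simp add: lin_uminus)
qed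

text \<open>
  At an element \<open>v\<close> of minimal length in the support, \<open>f\<close> is divisible by all \<open>\<ell>(v)\<close> inversions
  of \<open>v\<close>, which is too much for degree \<open>d < \<ell>(v)\<close>.
\<close>

lemma gkm_vanishing:
  assumes f: "gkm f" "\<And>v. v \<in> weyl R \<Longrightarrow> homogeneous d (f v)"
    and low: "\<And>v. v \<in> weyl R \<Longrightarrow> len v \<le> d \<Longrightarrow> f v = 0"
    and v: "v \<in> weyl R"
  shows "f v = 0"
  using v
proof (induction "len v" arbitrary: v rule: less_induct)
  case less
  show ?case
  proof (rule ccontr)
    assume nz: "f v \<noteq> 0"
    have inv: "inversions v \<subseteq> pos_roots R" by (auto simp: inversions_def)
    have "(\<Prod>a\<in>inversions v. lin R a) dvd f v"
    proof (rule prod_lin_dvd[OF finite_inversions inv])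
      fix a assume "a \<in> inversions v"
      then have a: "a \<in> pos_roots R" "inv v a \<in> neg_roots R" by (auto simp: inversions_def)
      have "reflection a \<circ> v \<in> weyl R"
        using a less.prems by (simp add: comp_weyl reflection_weyl pos_rootsD)
      then have "f (reflection a \<circ> v) = 0"
        using less.hyps len_reflection_less[OF less.prems a] by simp
      then show "lin R a dvd f v" using f(1) a less.prems unfolding gkm_def
        by (metis diff_0 dvd_minus_iff)
    qed
    then obtain h where h: "f v = (\<Prod>a\<in>inversions v. lin R a) * h" ..
    then have "card (inversions v) \<le> d"
      using homogeneous_factor[of d _ h, OF _ homogeneous_prod_lin[of "inversions v"]]
        f(2)[OF less.prems] nz by auto
    then show False using low less.prems nz card_inversions by simp
  qed
qed

text \<open>
  The quotient \<open>g\<close> exists because \<open>v s\<^sub>i = s\<^sub>c v\<close> for the root \<open>c = v(\<alpha>\<^sub>i)\<close>.  For its divisibility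
  by \<open>b\<close> along \<open>s\<^sub>b\<close>, there are two cases.  If \<open>c = \<plusminus>b\<close> then \<open>s\<^sub>b v = v s\<^sub>i\<close>, and \<open>g\<close> has equal values
  at \<open>v\<close> and \<open>v s\<^sub>i\<close>.  Otherwise \<open>b\<close> divides \<open>c\<close> times the difference, because \<open>s\<^sub>b c\<close> and \<open>c\<close> agree
  modulo \<open>b\<close>, and \<open>b\<close> is a prime that does not divide \<open>c\<close>.
\<close>

lemma divided_difference:
  assumes f: "gkm f" and i: "i \<in> \<Delta>"
  obtains g where "gkm g"
    "\<And>v. v \<in> weyl R \<Longrightarrow> f (v \<circ> s i) = f v + lin R (v (\<alpha> i)) * g v"
proof -
  have root: "v (\<alpha> i) \<in> roots R" if "v \<in> weyl R" for v
    using that i by (simp add: weyl_root simple_in_roots)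
  have "\<forall>v\<in>weyl R. \<exists>h. f (v \<circ> s i) = f v + lin R (v (\<alpha> i)) * h"
  proof
    fix v assume v: "v \<in> weyl R"
    have "lin R (v (\<alpha> i)) dvd f (v \<circ> s i) - f v"
      using gkm_root[OF f v root[OF v]] weyl_conjugate[OF v] by simp
    then show "\<exists>h. f (v \<circ> s i) = f v + lin R (v (\<alpha> i)) * h"
      by (metis dvdE diff_add_cancel add.commute)
  qed
  then obtain g where g: "\<And>v. v \<in> weyl R \<Longrightarrow> f (v \<circ> s i) = f v + lin R (v (\<alpha> i)) * g v"
    by (metis bchoice)
  have "lin R b dvd g (reflection b \<circ> v) - g v" if v: "v \<in> weyl R" and b: "b \<in> pos_roots R" for v b
  proof -
    let ?c = "v (\<alpha> i)" and ?u = "reflection b \<circ> v"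
    have br: "b \<in> roots R" using b pos_rootsD by blast
    have u: "?u \<in> weyl R" using v br by (simp add: comp_weyl reflection_weyl)
    have c: "?c \<in> roots R" using root[OF v] .
    show ?thesis
    proof (cases "?c = b \<or> ?c = - b")
      case True
      then have "reflection b = reflection ?c" by auto
      then have us: "?u = v \<circ> s i" and uc: "?u (\<alpha> i) = - ?c"
        using weyl_conjugate[OF v, of "\<alpha> i"] by (simp_all add: weyl_uminus[OF v])
      have "f v = f ?u + lin R (- ?c) * g ?u"
        using g[OF u] unfolding uc unfolding us by simp
      moreover have "f ?u = f v + lin R ?c * g v" using g[OF v] us by simp
      ultimately have "lin R ?c * g ?u = lin R ?c * g v" using c by (auto simp: lin_uminus)
      then show ?thesis using lin_nonzero[OF c] by simp
    next
      case False
      have 1: "lin R b dvd f (reflection b \<circ> (v \<circ> s i)) - f (v \<circ> s i)"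
        using gkm_root[OF f _ br, of "v \<circ> s i"] comp_weyl[OF v simple_weyl[OF i]] by blast
      have 2: "lin R b dvd f ?u - f v" using gkm_root[OF f v br] .
      have 3: "lin R b dvd lin R (reflection b ?c) - lin R ?c"
        using lin_dvd_lin_reflection[OF br c] .
      have fu: "f (reflection b \<circ> (v \<circ> s i)) = f ?u + lin R (reflection b ?c) * g ?u"
        using g[OF u] by (simp add: comp_assoc)
      have "lin R ?c * (g ?u - g v) =
          (f (reflection b \<circ> (v \<circ> s i)) - f (v \<circ> s i)) - (f ?u - f v)
            - (lin R (reflection b ?c) - lin R ?c) * g ?u"
        unfolding fu g[OF v] by (simp add: algebra_simps)
      also have "lin R b dvd \<dots>" by (rule dvd_diff[OF dvd_diff[OF 1 2] dvd_mult2[OF 3]])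
      finally have "lin R b dvd lin R ?c \<or> lin R b dvd g ?u - g v" using lin_prime[OF br] by blast
      then show ?thesis using lin_dvd_lin[OF c br] False by blast
    qed
  qed
  then have "gkm g" by (simp add: gkm_def)
  then show ?thesis using that g by blast
qed

text \<open>
  Properties of the flow-up class of \<open>w\<close> in \<open>G/B\<close> that determine its values on \<open>W\<close>.  The
  vanishing condition speaks of lengths instead of the Bruhat order: this suffices for uniqueness and
  is visibly inherited by divided differences.
\<close>

definition schubert_class :: "('v \<Rightarrow> 'v) \<Rightarrow> (('v \<Rightarrow> 'v) \<Rightarrow> cpoly) \<Rightarrow> bool" where
  "schubert_class w f \<longleftrightarrow> gkm f \<and> (\<forall>v\<in>weyl R. homogeneous (len w) (f v)) \<and>
     (\<forall>v\<in>weyl R. len v \<le> len w \<longrightarrow> v \<noteq> w \<longrightarrow> f v = 0) \<and>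
     f w = (\<Prod>a\<in>inversions w. lin R a)"

text \<open>
  If \<open>g(v) \<noteq> 0\<close> then \<open>f\<close> is nonzero at \<open>v\<close> or at \<open>v s\<^sub>i\<close>, so for \<open>\<ell>(v) < \<ell>(w)\<close> the only
  possibility is \<open>v = w s\<^sub>i\<close>.  If \<open>w s\<^sub>i\<close> is longer than \<open>w\<close> nothing is left, and \<open>g\<close> vanishes by
  rigidity.  If it is shorter, the value of \<open>g\<close> there is \<open>f(w)\<close> without the factor \<open>-w(\<alpha>\<^sub>i)\<close>, the
  inversion of \<open>w\<close> that \<open>w s\<^sub>i\<close> lacks.
\<close>

lemma schubert_class_divided_difference:
  assumes f: "schubert_class w f" and w: "w \<in> weyl R" and i: "i \<in> \<Delta>"
  obtains g where "\<And>v. v \<in> weyl R \<Longrightarrow> f (v \<circ> s i) = f v + lin R (v (\<alpha> i)) * g v"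
    and "w (\<alpha> i) \<in> neg_roots R \<Longrightarrow> schubert_class (w \<circ> s i) g"
    and "\<And>v. w (\<alpha> i) \<in> pos_roots R \<Longrightarrow> v \<in> weyl R \<Longrightarrow> g v = 0"
proof -
  obtain g where g: "gkm g" and
    fg: "\<And>v. v \<in> weyl R \<Longrightarrow> f (v \<circ> s i) = f v + lin R (v (\<alpha> i)) * g v"
    using divided_difference[OF _ i] f unfolding schubert_class_def by blast
  have hom: "homogeneous (len w) (f v)" if "v \<in> weyl R" for v
    using f that unfolding schubert_class_def by blast
  have low: "f v = 0" if "v \<in> weyl R" "len v \<le> len w" "v \<noteq> w" for v
    using f that unfolding schubert_class_def by blast
  have vs: "v \<circ> s i \<in> weyl R" if "v \<in> weyl R" for v
    using that i by (simp add: comp_weyl simple_weyl)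
  have nz: "lin R (v (\<alpha> i)) \<noteq> 0" if "v \<in> weyl R" for v
    using that i by (simp add: lin_nonzero weyl_root simple_in_roots)
  have deg: "g v = 0 \<or> 1 \<le> len w \<and> homogeneous (len w - 1) (g v)" if v: "v \<in> weyl R" for v
  proof -
    have "homogeneous (len w) (lin R (v (\<alpha> i)) * g v)"
      using homogeneous_diff[OF hom[OF vs[OF v]] hom[OF v]] fg[OF v] by simp
    then show ?thesis using homogeneous_factor[OF _ homogeneous_lin nz[OF v]] by blast
  qed
  have glow: "g v = 0" if v: "v \<in> weyl R" and l: "len v < len w" and ne: "v \<noteq> w \<circ> s i" for v
  proof -
    have "v \<circ> s i \<noteq> w" using ne by (metis comp_simple_cancel)
    then have "f (v \<circ> s i) = 0" using low[OF vs[OF v]] len_simple_le[OF v i] l by simp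
    moreover have "f v = 0" using low v l by (metis less_imp_le less_irrefl)
    ultimately show ?thesis using fg[OF v] nz[OF v] by simp
  qed
  have "schubert_class (w \<circ> s i) g" if neg: "w (\<alpha> i) \<in> neg_roots R"
  proof -
    let ?u = "w \<circ> s i"
    have l: "Suc (len ?u) = len w" using len_simple_neg[OF w i neg] .
    have u: "?u \<in> weyl R" using vs[OF w] .
    have up: "?u (\<alpha> i) \<in> pos_roots R" using neg w by (simp add: weyl_uminus neg_iff)
    have "f w = f ?u + lin R (?u (\<alpha> i)) * g ?u" using fg[OF u] by simp
    moreover have "f ?u = 0"
    proof (rule low[OF u])
      show "len ?u \<le> len w" using l by simp
      show "?u \<noteq> w" using l by force
    qed
    moreover have "f w = lin R (?u (\<alpha> i)) * (\<Prod>a\<in>inversions ?u. lin R a)"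
    proof -
      have "f w = (\<Prod>a\<in>insert (?u (\<alpha> i)) (inversions ?u). lin R a)"
        using f inversions_comp_simple(1)[OF u i up] unfolding schubert_class_def comp_simple_cancel
        by (simp only:)
      also have "\<dots> = lin R (?u (\<alpha> i)) * (\<Prod>a\<in>inversions ?u. lin R a)"
        using finite_inversions inversions_comp_simple(2)[OF u i up] by (rule prod.insert)
      finally show ?thesis .
    qed
    ultimately have "g ?u = (\<Prod>a\<in>inversions ?u. lin R a)" using nz[OF u] by simp
    moreover have "homogeneous (len ?u) (g v)" if "v \<in> weyl R" for v
      using deg[OF that] l[symmetric] by auto
    moreover have "g v = 0" if "v \<in> weyl R" "len v \<le> len ?u" "v \<noteq> ?u" for v
      using glow[OF that(1) _ that(3)] that(2) l by simp
    ultimately show ?thesis using g unfolding schubert_class_def by blast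
  qed
  moreover have "g v = 0" if pos: "w (\<alpha> i) \<in> pos_roots R" and v: "v \<in> weyl R" for v
  \<comment> \<open>For \<open>\<ell>(w) = 0\<close> the truncated difference \<open>\<ell>(w) - 1\<close> is not the degree of \<open>g\<close>; but then a
    nonzero \<open>g\<close> would make a difference of constants divisible by a linear form.\<close>
  proof (cases "len w = 0")
    case True then show ?thesis using deg[OF v] by simp
  next
    case False
    show ?thesis
    proof (rule gkm_vanishing[OF g _ _ v])
      show "homogeneous (len w - 1) (g v)" if "v \<in> weyl R" for v
        using deg[OF that] by auto
      show "g v = 0" if "v \<in> weyl R" "len v \<le> len w - 1" for v
        using glow[OF that(1)] that(2) False len_simple_pos[OF w i pos] by fastforce
    qed
  qed
  ultimately show ?thesis using that fg by blast
qed

section \<open>The sum over reduced subwords\<close>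

lemma reduced_words_snoc:
  assumes w: "w \<in> weyl R" and i: "i \<in> \<Delta>"
  shows "cs @ [i] \<in> reduced_words R w \<longleftrightarrow>
    w (\<alpha> i) \<in> neg_roots R \<and> cs \<in> reduced_words R (w \<circ> s i)"
proof
  assume "cs @ [i] \<in> reduced_words R w"
  then have cs: "set cs \<subseteq> \<Delta>" "word cs \<circ> s i = w" "Suc (length cs) = len w"
    by (simp_all add: reduced_words_def is_word_def word_prod_append)
  have ws: "word cs = w \<circ> s i" using cs(2) comp_simple_cancel by metis
  have l: "len (w \<circ> s i) < len w" using len_word_le[OF cs(1)] cs(3) ws by simp
  then have "w (\<alpha> i) \<notin> pos_roots R" using len_simple_pos[OF w i] by auto
  then have n: "w (\<alpha> i) \<in> neg_roots R"
    using not_pos_iff w i weyl_root simple_in_roots by blast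
  then show "w (\<alpha> i) \<in> neg_roots R \<and> cs \<in> reduced_words R (w \<circ> s i)"
    using cs ws len_simple_neg[OF w i n] by (simp add: reduced_words_def is_word_def)
next
  assume *: "w (\<alpha> i) \<in> neg_roots R \<and> cs \<in> reduced_words R (w \<circ> s i)"
  then have cs: "set cs \<subseteq> \<Delta>" "word cs = w \<circ> s i" "length cs = len (w \<circ> s i)"
    by (simp_all add: reduced_words_def is_word_def)
  have "word (cs @ [i]) = w" unfolding word_prod_append cs(2) by simp
  then show "cs @ [i] \<in> reduced_words R w"
    using cs i len_simple_neg[OF w i] * by (simp add: reduced_words_def is_word_def)
qed

definition subword_sum :: "nat list \<Rightarrow> ('v \<Rightarrow> 'v) \<Rightarrow> cpoly" where
  "subword_sum bs w = (\<Sum>I | I \<subseteq> {..<length bs} \<and> nths bs I \<in> reduced_words R w.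
     \<Prod>i\<in>I. lin R (r_root R bs i))"

text \<open>
  Index sets are split according to whether they contain the last position.
\<close>

lemma subword_sum_snoc:
  assumes w: "w \<in> weyl R" and i: "i \<in> \<Delta>"
  shows "subword_sum (bs @ [i]) w = subword_sum bs w +
    (if w (\<alpha> i) \<in> neg_roots R then lin R (word bs (\<alpha> i)) * subword_sum bs (w \<circ> s i) else 0)"
proof -
  let ?l = "length bs"
  let ?A = "{I. I \<subseteq> {..<?l} \<and> nths bs I \<in> reduced_words R w}"
  let ?B = "{I. I \<subseteq> {..<?l} \<and> nths bs I @ [i] \<in> reduced_words R w}"
  let ?r = "\<lambda>I. \<Prod>k\<in>I. lin R (r_root R bs k)"
  let ?r' = "\<lambda>I. \<Prod>k\<in>I. lin R (r_root R (bs @ [i]) k)"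
  have fin: "finite ?A" "finite ?B"
    by (rule finite_subset[of _ "Pow {..<?l}"]; auto)+
  have root: "r_root R (bs @ [i]) k = r_root R bs k" if "k < ?l" for k
    using that by (simp add: r_root_def nth_append)
  have r: "?r' I = ?r I" if "I \<subseteq> {..<?l}" for I
    using that root by (intro prod.cong) auto
  have last: "r_root R (bs @ [i]) ?l = word bs (\<alpha> i)" by (simp add: r_root_def)
  have nths_low: "nths (bs @ [i]) I = nths bs I" if "I \<subseteq> {..<?l}" for I
    using that by (auto simp: nths_append nths_singleton)
  have nths_high: "nths (bs @ [i]) (insert ?l I) = nths bs I @ [i]" if "I \<subseteq> {..<?l}" for I
  proof -
    have "nths bs (insert ?l I) = nths bs I"
      unfolding nths_def
      by (intro arg_cong[where f = "map fst"] filter_cong refl) (auto dest: set_zip_rightD)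
    then show ?thesis by (simp add: nths_append nths_singleton)
  qed
  have split: "{I. I \<subseteq> {..<length (bs @ [i])} \<and> nths (bs @ [i]) I \<in> reduced_words R w} =
      ?A \<union> insert ?l ` ?B" (is "?S = _")
  proof (intro equalityI subsetI)
    fix I assume I: "I \<in> ?S"
    show "I \<in> ?A \<union> insert ?l ` ?B"
    proof (cases "?l \<in> I")
      case True
      then have eq: "I = insert ?l (I - {?l})" and sub: "I - {?l} \<subseteq> {..<?l}"
        using I by (auto simp: less_Suc_eq)
      then have "I - {?l} \<in> ?B" using I nths_high[OF sub] by auto
      then show ?thesis using eq by blast
    next
      case False
      then have "I \<subseteq> {..<?l}" using I by (auto simp: less_Suc_eq)
      then show ?thesis using I nths_low by simp
    qed
  next
    fix I assume "I \<in> ?A \<union> insert ?l ` ?B"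
    then show "I \<in> ?S"
      using nths_low nths_high by (auto simp: less_Suc_eq)
  qed
  have "subword_sum (bs @ [i]) w = sum ?r' ?A + sum ?r' (insert ?l ` ?B)"
    unfolding subword_sum_def split
    by (rule sum.union_disjoint) (use fin in auto)
  also have "sum ?r' ?A = subword_sum bs w"
    unfolding subword_sum_def by (rule sum.cong) (simp_all add: r)
  also have "sum ?r' (insert ?l ` ?B) = (\<Sum>I\<in>?B. ?r' (insert ?l I))"
  proof (rule sum.reindex_cong[OF _ refl refl])
    show "inj_on (insert ?l) ?B"
    proof (rule inj_onI)
      fix A B assume "A \<in> ?B" "B \<in> ?B" and eq: "insert ?l A = insert ?l B"
      then have "?l \<notin> A" "?l \<notin> B" by auto
      then show "A = B" using eq by (simp add: insert_ident)
    qed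
  qed
  also have "\<dots> = (\<Sum>I\<in>?B. lin R (word bs (\<alpha> i)) * ?r I)"
  proof (rule sum.cong[OF refl])
    fix I assume "I \<in> ?B"
    then have I: "I \<subseteq> {..<?l}" by simp
    then have "finite I" "?l \<notin> I" by (auto intro: finite_subset)
    then show "?r' (insert ?l I) = lin R (word bs (\<alpha> i)) * ?r I" by (simp add: last r[OF I])
  qed
  also have "\<dots> = (if w (\<alpha> i) \<in> neg_roots R
      then lin R (word bs (\<alpha> i)) * subword_sum bs (w \<circ> s i) else 0)"
    by (simp add: reduced_words_snoc[OF w i] subword_sum_def sum_distrib_left)
  finally show ?thesis .
qed

text \<open>
  Appending a letter changes the value of \<open>f\<close> and the sum in the same way.
\<close>

lemma schubert_class_eq_subword_sum:
  assumes "set bs \<subseteq> \<Delta>" "w \<in> weyl R" "schubert_class w f"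
  shows "f (word bs) = subword_sum bs w"
  using assms
proof (induction bs arbitrary: w f rule: rev_induct)
  case Nil
  have "[] \<in> reduced_words R w \<longleftrightarrow> w = id"
    using len_eq_0[OF Nil.prems(2)] by (auto simp: reduced_words_def is_word_def)
  then have "{I. I \<subseteq> {..<length []} \<and> nths [] I \<in> reduced_words R w} = (if w = id then {{}} else {})"
    by auto
  then have "subword_sum [] w = (if w = id then 1 else 0)"
    unfolding subword_sum_def by simp
  moreover have "f id = (if w = id then 1 else 0)"
    using Nil.prems(3) id_weyl inversions_id unfolding schubert_class_def by auto
  ultimately show ?case by (simp only: word_prod_simps)
next
  case (snoc i bs)
  have i: "i \<in> \<Delta>" and bs: "set bs \<subseteq> \<Delta>" using snoc.prems by auto
  obtain g where g: "\<And>v. v \<in> weyl R \<Longrightarrow> f (v \<circ> s i) = f v + lin R (v (\<alpha> i)) * g v"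
    and neg: "w (\<alpha> i) \<in> neg_roots R \<Longrightarrow> schubert_class (w \<circ> s i) g"
    and pos: "\<And>v. w (\<alpha> i) \<in> pos_roots R \<Longrightarrow> v \<in> weyl R \<Longrightarrow> g v = 0"
    using schubert_class_divided_difference[OF snoc.prems(3,2) i] by blast
  have v: "word bs \<in> weyl R" using bs word_weyl by blast
  have ws: "w \<circ> s i \<in> weyl R" using snoc.prems(2) i by (simp add: comp_weyl simple_weyl)
  have "f (word (bs @ [i])) = subword_sum bs w + lin R (word bs (\<alpha> i)) * g (word bs)"
    using g[OF v] snoc.IH[OF bs snoc.prems(2,3)] by (simp add: word_prod_append)
  also have "\<dots> = subword_sum (bs @ [i]) w"
  proof (cases "w (\<alpha> i) \<in> neg_roots R")
    case True
    then show ?thesis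
      by (simp only: subword_sum_snoc[OF snoc.prems(2) i] snoc.IH[OF bs ws neg[OF True]] if_True)
  next
    case False
    then have "w (\<alpha> i) \<in> pos_roots R"
      using not_neg_iff weyl_root[OF snoc.prems(2)] simple_in_roots[OF i] by blast
    then show ?thesis using False pos[OF _ v] by (simp add: subword_sum_snoc[OF snoc.prems(2) i])
  qed
  finally show ?case .
qed


section \<open>Cosets of parabolic subgroups and flow-up classes\<close>

context
  fixes J :: "nat set"
  assumes J: "J \<subseteq> \<Delta>"
begin

lemma parabolic_weyl: "u \<in> parabolic R J \<Longrightarrow> u \<in> weyl R"
  unfolding parabolic_def weyl_eq_simple using reflection_group_mono[of "\<alpha> ` J" "\<alpha> ` \<Delta>"] J by blast

lemma comp_parabolic: "u \<in> parabolic R J \<Longrightarrow> x \<in> parabolic R J \<Longrightarrow> u \<circ> x \<in> parabolic R J"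
  unfolding parabolic_def by (rule reflection_group_comp)

lemma inv_parabolic: "u \<in> parabolic R J \<Longrightarrow> inv u \<in> parabolic R J"
  unfolding parabolic_def by (rule reflection_group_inv)

lemma simple_parabolic: "j \<in> J \<Longrightarrow> s j \<in> parabolic R J"
  unfolding parabolic_def by (rule reflection_group_reflection) simp

lemma comp_inv: "u \<in> weyl R \<Longrightarrow> u \<circ> inv u = id"
  using inv_cancel(2) by (simp add: fun_eq_iff)

lemma in_coset_self: "w \<in> coset R J w"
proof -
  have "id \<in> parabolic R J" unfolding parabolic_def by (rule reflection_group.one)
  moreover have "w = w \<circ> id" by simp
  ultimately show ?thesis unfolding coset_def by blast
qed

lemma coset_comp: "x \<in> coset R J w \<Longrightarrow> u \<in> parabolic R J \<Longrightarrow> x \<circ> u \<in> coset R J w"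
  unfolding coset_def using comp_parabolic by (auto simp: comp_assoc)

lemma coset_eqI:
  assumes "x \<in> coset R J w"
  shows "coset R J x = coset R J w"
proof
  obtain u where u: "u \<in> parabolic R J" "x = w \<circ> u" using assms unfolding coset_def by blast
  show "coset R J x \<subseteq> coset R J w"
    using coset_comp[OF assms] unfolding coset_def[of R J x] by blast
  have "w = x \<circ> inv u"
    unfolding u(2) comp_assoc comp_inv[OF parabolic_weyl[OF u(1)]] by simp
  then have w: "w \<in> coset R J x" using inv_parabolic[OF u(1)] unfolding coset_def by blast
  show "coset R J w \<subseteq> coset R J x"
    using coset_comp[OF w] unfolding coset_def[of R J w] by blast
qed

lemma coset_left_mult: "coset R J (g \<circ> x) = (\<lambda>y. g \<circ> y) ` coset R J x"
  unfolding coset_def by (auto simp: comp_assoc)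

lemma reflection_in_parabolic:
  assumes u: "u \<in> parabolic R J" and a: "a \<in> pos_roots R" "inv u a \<in> neg_roots R"
  shows "reflection a \<in> parabolic R J"
proof -
  obtain bs where bs: "set bs \<subseteq> J" "word bs = u"
    using u reflection_group_eq_words unfolding parabolic_def by metis
  then obtain cs where cs: "set cs \<subseteq> J" "word cs = reflection a \<circ> u"
    using exchange[OF bs(1) J a(1)] a(2) by auto
  then have "reflection a \<circ> u \<in> parabolic R J"
    using reflection_group_eq_words unfolding parabolic_def by metis
  then have "reflection a \<circ> u \<circ> inv u \<in> parabolic R J"
    by (rule comp_parabolic[OF _ inv_parabolic[OF u]])
  then show ?thesis unfolding comp_assoc comp_inv[OF parabolic_weyl[OF u]] by simp
qed

text \<open>
  Write \<open>u\<close> as a word in the letters \<open>J\<close> that is shortest among such words, and let \<open>j\<close> be its last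
  letter.  If \<open>u(\<alpha>\<^sub>j)\<close> were positive, the exchange property would give a shorter word in the
  same letters.
\<close>

lemma parabolic_descent:
  assumes u: "u \<in> parabolic R J" "u \<noteq> id"
  obtains j where "j \<in> J" "u (\<alpha> j) \<in> neg_roots R"
proof -
  let ?P = "\<lambda>bs. set bs \<subseteq> J \<and> word bs = u"
  obtain bs where "?P bs"
    using u(1) unfolding parabolic_def reflection_group_eq_words by blast
  then have "\<exists>us. ?P us \<and> (\<forall>bs. ?P bs \<longrightarrow> length us \<le> length bs)"
    by (rule ex_has_least_nat)
  then obtain us where us: "set us \<subseteq> J" "word us = u"
    and least: "\<And>bs. set bs \<subseteq> J \<Longrightarrow> word bs = u \<Longrightarrow> length us \<le> length bs"
    by blast
  have "us \<noteq> []" using us(2) u(2) by auto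
  then obtain cs j where cs: "us = cs @ [j]" by (metis rev_exhaust)
  have j: "j \<in> J" "j \<in> \<Delta>" and csJ: "set cs \<subseteq> J" and eq: "u = word cs \<circ> s j"
    using us cs J by (auto simp: word_prod_append)
  have c: "word cs \<in> weyl R" using csJ J word_weyl by blast
  have ua: "u (\<alpha> j) = - word cs (\<alpha> j)" unfolding eq by (simp add: weyl_uminus[OF c])
  have "u (\<alpha> j) \<notin> pos_roots R"
  proof
    assume p: "u (\<alpha> j) \<in> pos_roots R"
    have "inv (word cs) (u (\<alpha> j)) = - \<alpha> j"
      unfolding ua by (simp add: weyl_uminus[OF inv_weyl[OF c]] inv_cancel[OF c])
    then have "inv (word cs) (u (\<alpha> j)) \<in> neg_roots R"
      using simple_pos[OF j(2)] by (simp add: neg_iff)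
    then obtain ds where ds: "set ds \<subseteq> J" "length ds < length cs"
      "word ds = reflection (u (\<alpha> j)) \<circ> word cs"
      using exchange[OF csJ J p] by blast
    have "word ds = reflection (word cs (\<alpha> j)) \<circ> word cs"
      unfolding ds(3) ua reflection_uminus ..
    also have "\<dots> = u" unfolding eq by (rule weyl_conjugate[OF c])
    finally have "word ds = u" .
    then show False using least[OF ds(1)] ds(2) cs by simp
  qed
  then have "u (\<alpha> j) \<in> neg_roots R"
    using not_pos_iff weyl_root[OF parabolic_weyl[OF u(1)]] simple_in_roots[OF j(2)] by blast
  then show ?thesis using that j by blast
qed

lemma reflection_comp_in_coset:
  assumes w: "w \<in> weyl R" and r: "reflection b \<in> parabolic R J"
  shows "reflection (w b) \<circ> w \<in> coset R J w"
  unfolding weyl_conjugate[OF w] using coset_comp[OF in_coset_self r] .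

text \<open>
  Let \<open>v = w u\<close> with \<open>u \<noteq> id\<close>, and choose \<open>j\<close> in \<open>J\<close> with \<open>u(\<alpha>\<^sub>j) < 0\<close>.  Then either
  \<open>v(\<alpha>\<^sub>j) < 0\<close> and \<open>v s\<^sub>j\<close> is shorter than \<open>v\<close>, or \<open>v(\<alpha>\<^sub>j)\<close> is an inversion of \<open>w\<close>
  and reflecting in it shortens \<open>w\<close>; neither leaves the coset.
\<close>

lemma min_rep_unique:
  assumes w: "w \<in> weyl R" and mw: "min_rep R (coset R J w) w" and mv: "min_rep R (coset R J w) v"
  shows "v = w"
proof (rule ccontr)
  assume ne: "v \<noteq> w"
  obtain u where u: "u \<in> parabolic R J" "v = w \<circ> u"
    using mv unfolding min_rep_def coset_def by blast
  have "u \<noteq> id" using ne u(2) comp_id by metis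
  then obtain j where j: "j \<in> J" "u (\<alpha> j) \<in> neg_roots R"
    using parabolic_descent[OF u(1)] by blast
  have uW: "u \<in> weyl R" using parabolic_weyl[OF u(1)] .
  have vW: "v \<in> weyl R" using u(2) comp_weyl[OF w uW] by simp
  have jD: "j \<in> \<Delta>" using j J by blast
  have vcos: "v \<in> coset R J w" using mv unfolding min_rep_def by blast
  have "v (\<alpha> j) \<in> roots R" using weyl_root[OF vW simple_in_roots[OF jD]] .
  then consider "v (\<alpha> j) \<in> neg_roots R" | "v (\<alpha> j) \<in> pos_roots R" using root_cases by blast
  then show False
  proof cases
    case 1
    then have "len (v \<circ> s j) < len v" using len_simple_less[OF vW jD] by blast
    moreover have "v \<circ> s j \<in> coset R J w" using coset_comp[OF vcos simple_parabolic[OF j(1)]] .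
    ultimately show False using mv unfolding min_rep_def by fastforce
  next
    case 2
    have va: "v (\<alpha> j) = w (u (\<alpha> j))" using u(2) by simp
    have "len (reflection (v (\<alpha> j)) \<circ> w) < len w"
      by (rule len_reflection_less[OF w 2]) (simp add: va inv_cancel[OF w] j)
    moreover have "reflection (v (\<alpha> j)) \<circ> w \<in> coset R J w"
      unfolding va
    proof (rule reflection_comp_in_coset[OF w])
      have "reflection (u (\<alpha> j)) = u \<circ> s j \<circ> inv u"
        unfolding weyl_conjugate[OF uW, symmetric] comp_assoc comp_inv[OF uW] by simp
      then show "reflection (u (\<alpha> j)) \<in> parabolic R J"
        using comp_parabolic[OF comp_parabolic[OF u(1) simple_parabolic[OF j(1)]] inv_parabolic[OF u(1)]]
        by (simp only:)
    qed
    ultimately show False using mw unfolding min_rep_def by fastforce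
  qed
qed

text \<open>
  Both kinds of edges in the definition of the moment graph are one kind, read from either end:
  replacing \<open>x\<close> by \<open>s\<^sub>a x\<close> changes the sign of \<open>x\<^sup>-\<^sup>1 a\<close>.
\<close>

lemma moment_graph_edge:
  assumes "e \<in> moment_graph R J"
  shows "\<exists>x a. x \<in> weyl R \<and> a \<in> pos_roots R \<and>
    coset R J (reflection a \<circ> x) \<noteq> coset R J x \<and> inv x a \<in> neg_roots R \<and>
    e = (coset R J x, a, coset R J (reflection a \<circ> x))"
proof -
  obtain x a where x: "x \<in> weyl R" and a: "a \<in> pos_roots R"
    and ne: "coset R J (reflection a \<circ> x) \<noteq> coset R J x"
    and cases: "inv x a \<in> neg_roots R \<and> e = (coset R J x, a, coset R J (reflection a \<circ> x)) \<or>
      inv x a \<notin> neg_roots R \<and> e = (coset R J (reflection a \<circ> x), a, coset R J x)"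
    using assms unfolding moment_graph_def by blast
  from cases show ?thesis
  proof
    assume "inv x a \<in> neg_roots R \<and> e = (coset R J x, a, coset R J (reflection a \<circ> x))"
    then show ?thesis using x a ne by blast
  next
    assume n: "inv x a \<notin> neg_roots R \<and> e = (coset R J (reflection a \<circ> x), a, coset R J x)"
    let ?y = "reflection a \<circ> x"
    have ar: "a \<in> roots R" using a pos_rootsD by blast
    have y: "?y \<in> weyl R" using x ar by (intro comp_weyl reflection_weyl)
    have yx: "reflection a \<circ> ?y = x" by (simp add: comp_assoc[symmetric])
    have "inv ?y a = - inv x a"
      unfolding inv_reflection_comp[OF x] by (simp add: weyl_uminus[OF inv_weyl[OF x]])
    moreover have "inv x a \<in> pos_roots R"
      using n not_neg_iff weyl_root[OF inv_weyl[OF x] ar] by blast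
    ultimately have "inv ?y a \<in> neg_roots R" by (simp only: neg_uminus_iff)
    moreover have "coset R J (reflection a \<circ> ?y) \<noteq> coset R J ?y"
      "e = (coset R J ?y, a, coset R J (reflection a \<circ> ?y))"
      using ne n unfolding yx by auto
    ultimately show ?thesis using y a by blast
  qed
qed

text \<open>
  An edge out of \<open>[w]\<close> may be given by another representative \<open>w u\<close>.  If its label \<open>a\<close> were not an
  inversion of \<open>w\<close>, then \<open>u\<^sup>-\<^sup>1\<close> would make the positive root \<open>w\<^sup>-\<^sup>1 a\<close> negative; the reflection in
  that root would lie in \<open>W\<^sub>J\<close>, and the edge would be a loop.  Conversely the edge of an inversion is not
  a loop, because reflecting in it shortens \<open>w\<close>, which is minimal in its coset.
\<close>

lemma outgoing_edges:
  assumes w: "w \<in> weyl R" and mw: "min_rep R (coset R J w) w"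
  shows "{e \<in> moment_graph R J. fst e = coset R J w} =
    (\<lambda>a. (coset R J w, a, coset R J (reflection a \<circ> w))) ` inversions w"
proof (intro equalityI subsetI)
  fix e assume "e \<in> {e \<in> moment_graph R J. fst e = coset R J w}"
  then have e: "e \<in> moment_graph R J" and fe: "fst e = coset R J w" by auto
  obtain x a where x: "x \<in> weyl R" and a: "a \<in> pos_roots R"
    and ne: "coset R J (reflection a \<circ> x) \<noteq> coset R J x" and n: "inv x a \<in> neg_roots R"
    and eq: "e = (coset R J x, a, coset R J (reflection a \<circ> x))"
    using moment_graph_edge[OF e] by blast
  have cx: "coset R J x = coset R J w" using eq fe by simp
  have cr: "coset R J (reflection a \<circ> x) = coset R J (reflection a \<circ> w)"
    unfolding coset_left_mult cx ..
  have "inv w a \<in> neg_roots R"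
  proof (rule ccontr)
    assume "inv w a \<notin> neg_roots R"
    then have p: "inv w a \<in> pos_roots R"
      using not_neg_iff weyl_root[OF inv_weyl[OF w] pos_rootsD[OF a]] by blast
    obtain u where u: "u \<in> parabolic R J" "x = w \<circ> u"
      using in_coset_self[of x] cx unfolding coset_def by blast
    have "inv x a = inv u (inv w a)"
      unfolding u(2) o_inv_distrib[OF bij_weyl[OF w] bij_weyl[OF parabolic_weyl[OF u(1)]]] by simp
    then have "reflection (inv w a) \<in> parabolic R J"
      using reflection_in_parabolic[OF u(1) p] n by simp
    then have "reflection a \<circ> w \<in> coset R J w"
      using reflection_comp_in_coset[OF w, of "inv w a"] by (simp only: inv_cancel[OF w])
    then have "coset R J (reflection a \<circ> w) = coset R J w" by (rule coset_eqI)
    then show False using ne cr cx by simp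
  qed
  then show "e \<in> (\<lambda>a. (coset R J w, a, coset R J (reflection a \<circ> w))) ` inversions w"
    using a unfolding eq cx cr by (simp add: inversions_def)
next
  fix e assume "e \<in> (\<lambda>a. (coset R J w, a, coset R J (reflection a \<circ> w))) ` inversions w"
  then obtain a where a: "a \<in> pos_roots R" "inv w a \<in> neg_roots R"
    and e: "e = (coset R J w, a, coset R J (reflection a \<circ> w))"
    unfolding inversions_def by blast
  have "coset R J (reflection a \<circ> w) \<noteq> coset R J w"
  proof
    assume "coset R J (reflection a \<circ> w) = coset R J w"
    then have "reflection a \<circ> w \<in> coset R J w" using in_coset_self by blast
    then show False
      using len_reflection_less[OF w a] mw unfolding min_rep_def by fastforce
  qed
  then have "e \<in> moment_graph R J"
    unfolding moment_graph_def using w a e by blast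
  then show "e \<in> {e \<in> moment_graph R J. fst e = coset R J w}" using e by simp
qed

lemma bruhat_le_len: "bruhat_le R x y \<Longrightarrow> x = y \<or> len x < len y"
  unfolding bruhat_le_def
  by (induction rule: rtranclp_induct) (auto simp: bruhat_step_def)

text \<open>
  The degree is that of the value at \<open>w\<close>.  If the class is nonzero at some \<open>v\<close> with
  \<open>\<ell>(v) \<le> \<ell>(w)\<close>, then the Bruhat order between minimal representatives forces \<open>w\<close> to be the minimal
  representative of \<open>[v]\<close>, whence \<open>v\<close> is minimal as well and equals \<open>w\<close>.
\<close>

lemma schubert_class_flow_up_class:
  assumes w: "w \<in> weyl R" and mw: "min_rep R (coset R J w) w"
    and p: "flow_up_class R J (coset R J w) p"
  shows "schubert_class w (\<lambda>v. p (coset R J v))"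
proof -
  have quot: "coset R J v \<in> weyl_quot R J" if "v \<in> weyl R" for v
    using that unfolding weyl_quot_def by blast
  have H: "p \<in> equiv_cohomology R J" and
    supp: "\<And>v. v \<in> weyl R \<Longrightarrow> p (coset R J v) \<noteq> 0 \<Longrightarrow> quot_le R (coset R J w) (coset R J v)"
    and pw: "p (coset R J w) = (\<Prod>(C', a, D) \<in> {e \<in> moment_graph R J. fst e = coset R J w}. lin R a)"
    using p quot unfolding flow_up_class_def by blast+
  obtain d where d: "\<And>v. v \<in> weyl R \<Longrightarrow> homogeneous d (p (coset R J v))"
    using p quot unfolding flow_up_class_def by blast
  have gkm: "gkm (\<lambda>v. p (coset R J v))"
    unfolding gkm_def
  proof (intro ballI)
    fix v a assume v: "v \<in> weyl R" and a: "a \<in> pos_roots R"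
    show "lin R a dvd p (coset R J (reflection a \<circ> v)) - p (coset R J v)"
    proof (cases "coset R J (reflection a \<circ> v) = coset R J v")
      case False
      then have "p (coset R J (reflection a \<circ> v)) - p (coset R J v) \<in> principal_ideal R a"
        using H v a unfolding equiv_cohomology_def by blast
      then show ?thesis unfolding principal_ideal_def by auto
    qed simp
  qed
  have pw': "p (coset R J w) = (\<Prod>a\<in>inversions w. lin R a)"
    unfolding pw outgoing_edges[OF w mw]
    by (subst prod.reindex) (simp_all add: inj_on_def)
  have inv: "inversions w \<subseteq> roots R" using pos_rootsD by (auto simp: inversions_def)
  have "d = len w"
    using homogeneous_unique[OF d[OF w], of "len w"] homogeneous_prod_lin[of "inversions w"]
      prod_lin_nonzero[OF inv] card_inversions[OF w] unfolding pw' by simp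
  moreover have "p (coset R J v) = 0" if v: "v \<in> weyl R" and l: "len v \<le> len w" and ne: "v \<noteq> w" for v
  proof (rule ccontr)
    assume "p (coset R J v) \<noteq> 0"
    then obtain u v' where u: "min_rep R (coset R J w) u" and v': "min_rep R (coset R J v) v'"
      and le: "bruhat_le R u v'"
      using supp[OF v] unfolding quot_le_def by blast
    have "u = w" using min_rep_unique[OF w mw u] .
    moreover have "len v' \<le> len v" using v' in_coset_self unfolding min_rep_def by blast
    ultimately have "w = v'" using bruhat_le_len[OF le] l by auto
    then have "w \<in> coset R J v" using v' unfolding min_rep_def by blast
    then have cw: "coset R J v = coset R J w" using coset_eqI by metis
    then have "v \<in> coset R J w" using in_coset_self by metis
    then have "min_rep R (coset R J w) v" using mw l unfolding min_rep_def by (metis le_trans)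
    then show False using min_rep_unique[OF w mw] ne by blast
  qed
  ultimately show ?thesis using gkm d pw' unfolding schubert_class_def by blast
qed

end

end

theorem theorem7p1:
  fixes R :: "'v::real_inner root_data"
    and J :: "nat set"
    and v w :: "'v \<Rightarrow> 'v"
    and bs :: "nat list"
    and p q :: "('v \<Rightarrow> 'v) set \<Rightarrow> cpoly"
  assumes "based_root_system R"
    and "J \<subseteq> {1..rank R}"
    and "v \<in> weyl R" and "w \<in> weyl R"
    and "min_rep R (coset R J v) v" and "min_rep R (coset R J w) w"
    and "bs \<in> reduced_words R v"
    and "flow_up_class R J (coset R J w) p"
    and "flow_up_class R {} (coset R {} w) q"
  shows "p (coset R J v) = q (coset R {} v) \<and>
    q (coset R {} v) =
      (\<Sum>I | I \<subseteq> {..<length bs} \<and> nths bs I \<in> reduced_words R w.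
         \<Prod>i\<in>I. lin R (r_root R bs i))"
proof -
  interpret based_roots R by unfold_locales (rule assms(1))
  have bs: "set bs \<subseteq> {1..rank R}" "word_prod R bs = v"
    using assms(7) unfolding reduced_words_def is_word_def by auto
  have "parabolic R {} = {id}"
    unfolding parabolic_def
  proof (intro equalityI subsetI)
    fix u assume "u \<in> reflection_group (simple_root R ` {})"
    then show "u \<in> {id}" by cases auto
  next
    fix u :: "'v \<Rightarrow> 'v" assume "u \<in> {id}"
    then show "u \<in> reflection_group (simple_root R ` {})" using reflection_group.one by blast
  qed
  then have "min_rep R (coset R {} w) w" unfolding min_rep_def coset_def by auto
  then have "schubert_class w (\<lambda>v. q (coset R {} v))"
    by (rule schubert_class_flow_up_class[OF empty_subsetI assms(4) _ assms(9)])
  then have q: "q (coset R {} v) = subword_sum bs w"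
    using schubert_class_eq_subword_sum[OF bs(1) assms(4)] unfolding bs(2) by blast
  have "schubert_class w (\<lambda>v. p (coset R J v))"
    by (rule schubert_class_flow_up_class[OF assms(2,4,6,8)])
  then have p: "p (coset R J v) = subword_sum bs w"
    using schubert_class_eq_subword_sum[OF bs(1) assms(4)] unfolding bs(2) by blast
  show ?thesis unfolding p q subword_sum_def by simp
qed

end
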